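(* Let $\mathrm{V}$ be a finite vertex set, let $\mathfrak{G}_{\mathrm{poly}}$ be the class of all polytree CPDAGs over $\mathrm{V}$, and let $\mathcal{L}_{\mathrm{poly}}=(\mathfrak{G}_{\mathrm{poly}},\preceq)$ be the poset with $\mathcal{G}_1\preceq\mathcal{G}_2$ if and only if $\mathcal{M}^{\mathrm{o}}_{\mathrm{CPDAG}}(\mathcal{G}_1)\subseteq\mathcal{M}^{\mathrm{o}}_{\mathrm{CPDAG}}(\mathcal{G}_2)$. Then: 1. The least element is the empty graph. There is no greatest element when $|\mathrm{V}|>2$. 2. For $\mathcal{G}_1,\mathcal{G}_2\in\mathfrak{G}_{\mathrm{poly}}$, $\mathcal{G}_1\preceq\mathcal{G}_2$ if and only if there exist DAGs $\mathcal{D}_1\in[\mathcal{G}_1]$ and $\mathcal{D}_2\in[\mathcal{G}_2]$ such that $\mathcal{D}_1$ is a subgraph of $\mathcal{D}_2$. 3. $\mathcal{L}_{\mathrm{poly}}$ is graded with $\mathrm{rank}(\mathcal{G})$ equal to the number of edges of $\mathcal{G}$. 4. $\mathcal{L}_{\mathrm{poly}}$ is lower semimodular. 5. $d_{\mathcal{L}_{\mathrm{poly}}}(\mathcal{G}_s,\mathcal{G}_t)=d_{\mathcal{L}_{\mathrm{poly}},\downarrow\uparrow}(\mathcal{G}_s,\mathcal{G}_t)$ for every $\mathcal{G}_s,\mathcal{G}_t\in\mathfrak{G}_{\mathrm{poly}}$.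
   Context: Graphs. Two DAGs over $\mathrm{V}$ are Markov equivalent if they have the same d-separations (equivalently, the same skeleton and the same v-structures $a\to b\leftarrow c$ with $a,c$ nonadjacent). A CPDAG $\mathcal{G}$ represents a Markov equivalence class $[\mathcal{G}]$ of DAGs: it has the common skeleton, an edge is directed if it has the same direction in every DAG of the class, and undirected otherwise. It is a polytree if its skeleton (the graph with all edges made undirected) has no cycles (so it is a forest, not necessarily connected). A subgraph is over the same vertex set with a subset of the directed edges. Model. For each $v\in\mathrm{V}$ let $\mathcal{X}_v$ be a measurable space with a $\sigma$-finite measure $\mu_v$ that is nondegenerate (there are two disjoint measurable sets of positive $\mu_v$-measure), $\mu=\prod_v\mu_v$. $\mathcal{M}^{\mathrm{o}}_{\mathrm{CPDAG}}(\mathcal{G})$ is the set of laws $P$ of $X=(X_v)_{v\in\mathrm{V}}$ on $\prod_v\mathcal{X}_v$, absolutely continuous with respect to $\mu$, such that for any (equivalently every) $\mathcal{D}\in[\mathcal{G}]$ and all disjoint $\mathrm{A},\mathrm{B},\mathrm{C}\subset\mathrm{V}$: if $\mathrm{A}$ and $\mathrm{B}$ are d-separated by $\mathrm{C}$ in $\mathcal{D}$, then $X_{\mathrm{A}}$ and $X_{\mathrm{B}}$ are conditionally independent given $X_{\mathrm{C}}$ under $P$. Poset terms: $x\lessdot y$ ($y$ covers $x$) if $x\prec y$ with nothing strictly between. A poset is connected if any two elements are joined by a path, i.e. a sequence in which of any two consecutive elements one covers the other. A connected poset is graded with rank function $\mathrm{rank}$ (valued in $\mathbb{N}$) if $x\lessdot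 y$ implies $\mathrm{rank}(y)=\mathrm{rank}(x)+1$, and $\mathrm{rank}(x)=0$ for some minimal $x$. Lower semimodular: whenever $z$ covers $x$ and $y$ with $x\ne y$, some $w$ is covered by both $x$ and $y$. $d_{\mathcal{L}_{\mathrm{poly}}}(\mathcal{G}_s,\mathcal{G}_t)$ is the minimum length of a path from $\mathcal{G}_s$ to $\mathcal{G}_t$ in $\mathcal{L}_{\mathrm{poly}}$; $d_{\mathcal{L}_{\mathrm{poly}},\downarrow\uparrow}(\mathcal{G}_s,\mathcal{G}_t)$ is the minimum length of a down-up path, i.e. one of the form $\mathcal{G}_s=x_0\gtrdot\cdots\gtrdot x_{i^*}\lessdot\cdots\lessdot x_d=\mathcal{G}_t$ with $0\le i^*\le d$. *)

theory Defs
  imports "HOL-Probability.Probability"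
begin

section \<open>Directed acyclic graphs and d-separation\<close>

definition dag :: "'v set \<Rightarrow> ('v \<times> 'v) set \<Rightarrow> bool" where
  "dag V D \<longleftrightarrow> D \<subseteq> V \<times> V \<and> acyclic D"

definition skeleton :: "('v \<times> 'v) set \<Rightarrow> 'v set set" where
  "skeleton D = {{u, v} | u v. (u, v) \<in> D}"

definition upath :: "'v set set \<Rightarrow> 'v list \<Rightarrow> bool" where
  "upath E p \<longleftrightarrow> p \<noteq> [] \<and> distinct p \<and> (\<forall>i. Suc i < length p \<longrightarrow> {p ! i, p ! Suc i} \<in> E)"

definition ucycle :: "'v set set \<Rightarrow> 'v list \<Rightarrow> bool" where
  "ucycle E p \<longleftrightarrow> length p \<ge> 3 \<and> upath E p \<and> {last p, hd p} \<in> E"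

definition collider :: "('v \<times> 'v) set \<Rightarrow> 'v \<Rightarrow> 'v \<Rightarrow> 'v \<Rightarrow> bool" where
  "collider D u w v \<longleftrightarrow> (u, w) \<in> D \<and> (v, w) \<in> D"

text \<open>Every vertex counts as its own descendant, hence the reflexive closure. Only inner vertices
  are tested for membership in \<open>C\<close>: the end points lie in sets that are disjoint from \<open>C\<close>
  wherever this is used.\<close>
definition d_connecting :: "('v \<times> 'v) set \<Rightarrow> 'v set \<Rightarrow> 'v list \<Rightarrow> bool" where
  "d_connecting D C p \<longleftrightarrow> upath (skeleton D) p \<and>
     (\<forall>i. Suc (Suc i) < length p \<longrightarrow>
        (if collider D (p ! i) (p ! Suc i) (p ! Suc (Suc i))
         then \<exists>c\<in>C. (p ! Suc i, c) \<in> D\<^sup>*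
         else p ! Suc i \<notin> C))"

definition d_separated :: "('v \<times> 'v) set \<Rightarrow> 'v set \<Rightarrow> 'v set \<Rightarrow> 'v set \<Rightarrow> bool" where
  "d_separated D A B C \<longleftrightarrow> \<not> (\<exists>p. d_connecting D C p \<and> hd p \<in> A \<and> last p \<in> B)"

definition disjoint_triple :: "'v set \<Rightarrow> 'v set \<Rightarrow> 'v set \<Rightarrow> 'v set \<Rightarrow> bool" where
  "disjoint_triple V A B C \<longleftrightarrow>
     A \<subseteq> V \<and> B \<subseteq> V \<and> C \<subseteq> V \<and> A \<inter> B = {} \<and> A \<inter> C = {} \<and> B \<inter> C = {}"

definition markov_equivalent :: "'v set \<Rightarrow> ('v \<times> 'v) set \<Rightarrow> ('v \<times> 'v) set \<Rightarrow> bool" where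
  "markov_equivalent V D D' \<longleftrightarrow>
     (\<forall>A B C. disjoint_triple V A B C \<longrightarrow> (d_separated D A B C \<longleftrightarrow> d_separated D' A B C))"


section \<open>CPDAGs\<close>

datatype 'v pdag =
  PDAG (directed_edges: "('v \<times> 'v) set") (undirected_edges: "'v set set")

definition pdag_skeleton :: "'v pdag \<Rightarrow> 'v set set" where
  "pdag_skeleton G = skeleton (directed_edges G) \<union> undirected_edges G"

definition num_edges :: "'v pdag \<Rightarrow> nat" where
  "num_edges G = card (directed_edges G) + card (undirected_edges G)"

definition empty_pdag :: "'v pdag" where
  "empty_pdag = PDAG {} {}"

definition markov_class :: "'v set \<Rightarrow> ('v \<times> 'v) set \<Rightarrow> ('v \<times> 'v) set set" where
  "markov_class V D = {D'. dag V D' \<and> markov_equivalent V D D'}"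

text \<open>The CPDAG representing the Markov equivalence class of the DAG \<open>D\<close>. The choice of \<open>D\<close> within
  the class is immaterial, as Markov equivalent DAGs have the same skeleton.\<close>
definition cpdag_of :: "'v set \<Rightarrow> ('v \<times> 'v) set \<Rightarrow> 'v pdag" where
  "cpdag_of V D =
     (let same = {(u, v). \<forall>D' \<in> markov_class V D. (u, v) \<in> D'}
      in PDAG same (skeleton D - skeleton same))"

text \<open>The class \<open>[G]\<close> of DAGs represented by the CPDAG \<open>G\<close>.\<close>
definition dags_of :: "'v set \<Rightarrow> 'v pdag \<Rightarrow> ('v \<times> 'v) set set" where
  "dags_of V G = {D. dag V D \<and> cpdag_of V D = G}"

definition cpdags :: "'v set \<Rightarrow> 'v pdag set" where
  "cpdags V = {cpdag_of V D | D. dag V D}"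

definition polytree_cpdags :: "'v set \<Rightarrow> 'v pdag set" where
  "polytree_cpdags V = {G \<in> cpdags V. \<nexists>p. ucycle (pdag_skeleton G) p}"


section \<open>Graphical models\<close>

definition nondegenerate :: "'a measure \<Rightarrow> bool" where
  "nondegenerate M \<longleftrightarrow>
     (\<exists>A\<in>sets M. \<exists>B\<in>sets M. A \<inter> B = {} \<and> emeasure M A > 0 \<and> emeasure M B > 0)"

text \<open>Conditional independence, under \<open>P\<close>, of the \<open>S\<close>-valued \<open>X\<close> and the \<open>T\<close>-valued \<open>Y\<close> given the
  \<open>U\<close>-valued \<open>Z\<close>; conditioning is on the \<open>\<sigma>\<close>-algebra generated by \<open>Z\<close>.\<close>
definition cond_indep_var ::
  "'w measure \<Rightarrow> 'b measure \<Rightarrow> ('w \<Rightarrow> 'b) \<Rightarrow> 'c measure \<Rightarrow> ('w \<Rightarrow> 'c) \<Rightarrow> 'd measure \<Rightarrow> ('w \<Rightarrow> 'd) \<Rightarrow> bool"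
  where
  "cond_indep_var P S X T Y U Z \<longleftrightarrow>
     (let cond_prob = (\<lambda>Q. real_cond_exp P (vimage_algebra (space P) Z U) (indicator Q)) in
      \<forall>E\<in>sets S. \<forall>F\<in>sets T.
        AE w in P. cond_prob ((X -` E \<inter> space P) \<inter> (Y -` F \<inter> space P)) w
                 = cond_prob (X -` E \<inter> space P) w * cond_prob (Y -` F \<inter> space P) w)"

text \<open>The sample spaces of the coordinates are carried by the measures \<open>\<mu> v\<close>, whose underlying sets
  may differ although they live in one type.\<close>
definition cpdag_model :: "'v set \<Rightarrow> ('v \<Rightarrow> 'a measure) \<Rightarrow> 'v pdag \<Rightarrow> ('v \<Rightarrow> 'a) measure set" where
  "cpdag_model V \<mu> G =
     {P. prob_space P \<and> sets P = sets (PiM V \<mu>) \<and> absolutely_continuous (PiM V \<mu>) P \<and>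
         (\<forall>D\<in>dags_of V G. \<forall>A B C. disjoint_triple V A B C \<longrightarrow> d_separated D A B C \<longrightarrow>
            cond_indep_var P (PiM A \<mu>) (\<lambda>x. restrict x A) (PiM B \<mu>) (\<lambda>x. restrict x B)
              (PiM C \<mu>) (\<lambda>x. restrict x C))}"

definition poly_order :: "'v set \<Rightarrow> ('v \<Rightarrow> 'a measure) \<Rightarrow> 'v pdag rel" where
  "poly_order V \<mu> = {(G1, G2). G1 \<in> polytree_cpdags V \<and> G2 \<in> polytree_cpdags V \<and>
     cpdag_model V \<mu> G1 \<subseteq> cpdag_model V \<mu> G2}"


section \<open>Posets\<close>

text \<open>A poset is given by its reflexive order relation \<open>r\<close>, so its set of elements is \<open>Field r\<close>.
  Read \<open>covered_by r x y\<close> as \<open>y\<close> covers \<open>x\<close>.\<close>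
definition covered_by :: "'g rel \<Rightarrow> 'g \<Rightarrow> 'g \<Rightarrow> bool" where
  "covered_by r x y \<longleftrightarrow> (x, y) \<in> r \<and> x \<noteq> y \<and>
     \<not> (\<exists>z. (x, z) \<in> r \<and> x \<noteq> z \<and> (z, y) \<in> r \<and> z \<noteq> y)"

definition poset_path :: "'g rel \<Rightarrow> 'g \<Rightarrow> 'g list \<Rightarrow> 'g \<Rightarrow> bool" where
  "poset_path r s p t \<longleftrightarrow> p \<noteq> [] \<and> set p \<subseteq> Field r \<and> hd p = s \<and> last p = t \<and>
     (\<forall>i. Suc i < length p \<longrightarrow>
        covered_by r (p ! i) (p ! Suc i) \<or> covered_by r (p ! Suc i) (p ! i))"

definition down_up_path :: "'g rel \<Rightarrow> 'g \<Rightarrow> 'g list \<Rightarrow> 'g \<Rightarrow> bool" where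
  "down_up_path r s p t \<longleftrightarrow> p \<noteq> [] \<and> set p \<subseteq> Field r \<and> hd p = s \<and> last p = t \<and>
     (\<exists>k<length p. \<forall>i. Suc i < length p \<longrightarrow>
        (if i < k then covered_by r (p ! Suc i) (p ! i)
         else covered_by r (p ! i) (p ! Suc i)))"

definition poset_connected :: "'g rel \<Rightarrow> bool" where
  "poset_connected r \<longleftrightarrow> (\<forall>x\<in>Field r. \<forall>y\<in>Field r. \<exists>p. poset_path r x p y)"

definition graded_with_rank :: "'g rel \<Rightarrow> ('g \<Rightarrow> nat) \<Rightarrow> bool" where
  "graded_with_rank r rk \<longleftrightarrow> Partial_order r \<and> poset_connected r \<and>
     (\<forall>x y. covered_by r x y \<longrightarrow> rk y = rk x + 1) \<and>
     (\<exists>x\<in>Field r. (\<forall>y. (y, x) \<in> r \<longrightarrow> y = x) \<and> rk x = 0)"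

definition lower_semimodular :: "'g rel \<Rightarrow> bool" where
  "lower_semimodular r \<longleftrightarrow>
     (\<forall>x y z. covered_by r x z \<and> covered_by r y z \<and> x \<noteq> y \<longrightarrow>
        (\<exists>w. covered_by r w x \<and> covered_by r w y))"

text \<open>The distances are infinite if there is no path of the required kind; the length of a path is
  its number of steps.\<close>
definition poset_dist :: "'g rel \<Rightarrow> 'g \<Rightarrow> 'g \<Rightarrow> enat" where
  "poset_dist r s t = Inf {enat (length p - 1) | p. poset_path r s p t}"

definition down_up_dist :: "'g rel \<Rightarrow> 'g \<Rightarrow> 'g \<Rightarrow> enat" where
  "down_up_dist r s t = Inf {enat (length p - 1) | p. down_up_path r s p t}"

end

(*
  A polytree has at most one path between two vertices, so Markov equivalence of polytrees amounts
  to equality of skeletons and colliders, and D1 is Markov equivalent to a subgraph of D2 iff D1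
  "embeds" into D2: its skeleton is contained in that of D2 and the two have the same colliders on
  all pairs of edges of D1. The point is that inclusion of the models is equivalent to embedding.

  An embedding maps d-connecting paths to d-connecting paths, so it gives an inclusion of models.
  If D1 does not embed into D2, choose in each coordinate a probability measure with an event of
  probability 1/2, and let s_v be the sign 1 or -1 according to whether this event occurs at v. Then
  one of three densities with respect to the product measure gives a law in the model of D1 only:
  1 + s_a s_b / 2 if a - b is an edge of D1 but not of D2, 1 + s_a s_b s_c / 2 if a -> b <- c is a
  collider of D1 but not of D2, and (1 + s_a s_b / 2) (1 + s_b s_c / 2) if it is a collider of D2
  while a - b - c is a path of D1 but not a collider.

  Hence the order is the subgraph order on representatives, in which the elements covered by the
  CPDAG of D are those of D with one edge removed. Two such removals commute, which is lower
  semimodularity, and replacing an up-down step by a down-up step does not lengthen a path.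
*)
theory Submission
  imports Defs
begin

section \<open>Paths in forests\<close>

text \<open>The subgraph relation between some representatives is not visibly transitive, because
  two different representatives of the middle CPDAG may occur. Embeddings compare only what all
  members of a class share, so any representatives will do.

  Separation statements concern arbitrary sets, but a test density couples at most three
  coordinates; as adjacent vertices are never separated, few distributions of these coordinates over
  \<open>A\<close>, \<open>B\<close>, \<open>C\<close> remain. The triple density makes any two of
  its signs independent, yet a and c dependent given b, as at a collider. In the product density s_b
  * s_b = 1 produces the term s_a s_c / 4, so a and c are dependent, but independent given b. Events
  of probability 1/2 make the signs centred, so every term with an unpaired sign integrates to 0.

  The coordinate measures are only \<sigma>-finite, so probability measures absolutely continuous
  with respect to them take their place; the models ask for no more than absolute continuity.
  Conditional independence is stated by conditional expectations: it is proved by exhibiting a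
  version and refuted by integrating products of signs.\<close>

lemma upath_iff_successively:
  "upath E p \<longleftrightarrow> p \<noteq> [] \<and> distinct p \<and> successively (\<lambda>u v. {u, v} \<in> E) p"
  by (auto simp: upath_def successively_conv_nth)

lemma upath_mono: "upath E p \<Longrightarrow> E \<subseteq> F \<Longrightarrow> upath F p"
  by (auto simp: upath_def)

lemma ucycle_mono: "ucycle E p \<Longrightarrow> E \<subseteq> F \<Longrightarrow> ucycle F p"
  using upath_mono by (auto simp: ucycle_def)

text \<open>Where the paths part, following \<open>p\<close> until it first meets \<open>q\<close>
  again and returning along \<open>q\<close> gives a cycle.\<close>

lemma forest_upath_unique:
  assumes "\<nexists>c. ucycle E c" "upath E p" "upath E q" "hd p = hd q" "last p = last q"
  shows "p = q"
  using assms(2-)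
proof (induction p arbitrary: q)
  case Nil
  then show ?case by (simp add: upath_iff_successively)
next
  case (Cons a p')
  obtain q' where q: "q = a # q'"
    using Cons.prems by (cases q) (auto simp: upath_iff_successively)
  show ?case
  proof (cases "p' = [] \<or> q' = []")
    case True
    then show ?thesis
      using Cons.prems q by (auto simp: upath_iff_successively split: if_splits)
  next
    case False
    then have p': "p' \<noteq> []" and q': "q' \<noteq> []" by auto
    have up: "upath E p'" "upath E q'" "last p' = last q'"
      using Cons.prems q p' q' by (auto simp: upath_iff_successively successively_Cons)
    show ?thesis
    proof (cases "hd p' = hd q'")
      case True
      then show ?thesis using Cons.IH up q by blast
    next
      case ne: False
      have "\<exists>x\<in>set p'. x \<in> set q'"
        using up(3) p' q' last_in_set by metis
      \<comment> \<open>Taking the first vertex of \<open>p'\<close> that lies on \<open>q'\<close>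
        keeps \<open>p1\<close> disjoint from \<open>q'\<close>, so the closed walk repeats no
        vertex.\<close>
      then obtain p1 z p2 where p1: "p' = p1 @ z # p2" "z \<in> set q'" "\<forall>x\<in>set p1. x \<notin> set q'"
        by (auto simp: split_list_first_prop_iff)
      obtain q1 q2 where q1: "q' = q1 @ z # q2"
        using p1(2) by (meson split_list)
      have sp: "successively (\<lambda>u v. {u, v} \<in> E) (a # p1 @ z # p2)" "distinct (a # p1 @ z # p2)"
        using Cons.prems(1) p1 by (auto simp: upath_iff_successively)
      have sq: "successively (\<lambda>u v. {u, v} \<in> E) (a # q1 @ z # q2)" "distinct (a # q1 @ z # q2)"
        using Cons.prems(2) q q1 by (auto simp: upath_iff_successively)
      have 1: "successively (\<lambda>u v. {u, v} \<in> E) ((a # p1) @ [z])"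
        using sp(1) successively_append_iff[of _ "(a # p1) @ [z]" p2] by simp
      have 2: "successively (\<lambda>u v. {u, v} \<in> E) (a # q1 @ [z])"
        using sq(1) successively_append_iff[of _ "a # q1 @ [z]" q2] by simp
      then have "successively (\<lambda>u v. {u, v} \<in> E) (rev (a # q1 @ [z]))"
        by (subst successively_rev) (simp add: insert_commute)
      then have 3: "successively (\<lambda>u v. {u, v} \<in> E) (z # rev q1 @ [a])" by simp
      have s: "successively (\<lambda>u v. {u, v} \<in> E) (((a # p1) @ [z]) @ rev q1)"
      proof -
        have "successively (\<lambda>u v. {u, v} \<in> E) (z # rev q1)"
          using 3 successively_append_iff[of _ "z # rev q1" "[a]"] by simp
        then show ?thesis
          unfolding successively_append_iff[of _ "(a # p1) @ [z]"] successively_Cons[of _ z]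
          using 1 by auto
      qed
      have l: "{last ((a # p1 @ [z]) @ rev q1), a} \<in> E"
        using 3 by (cases q1) (auto simp: successively_append_iff successively_Cons)
      have d: "distinct ((a # p1 @ [z]) @ rev q1)"
        using sp(2) sq(2) p1(3) q1 by auto
      \<comment> \<open>\<open>p1\<close> and \<open>q1\<close> cannot both be empty, as the second
        vertices of the paths differ; hence at least three vertices.\<close>
      have n: "length ((a # p1 @ [z]) @ rev q1) \<ge> 3"
        using ne p1 q1 by (cases p1; cases q1) auto
      have "ucycle E ((a # p1 @ [z]) @ rev q1)"
        using s l d n by (simp add: ucycle_def upath_iff_successively)
      then show ?thesis using assms(1) by blast
    qed
  qed
qed

section \<open>Separation in polytrees\<close>

lemma skeleton_iff: "{u, v} \<in> skeleton D \<longleftrightarrow> (u, v) \<in> D \<or> (v, u) \<in> D"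
  by (auto simp: skeleton_def doubleton_eq_iff)

lemma skeleton_mono: "D \<subseteq> D' \<Longrightarrow> skeleton D \<subseteq> skeleton D'"
  by (auto simp: skeleton_def)

lemma dag_asym: "dag V D \<Longrightarrow> (u, v) \<in> D \<Longrightarrow> (v, u) \<notin> D"
  by (meson dag_def acyclic_def trancl.simps)

lemma dag_irrefl: "dag V D \<Longrightarrow> (u, u) \<notin> D"
  using dag_asym by fast

lemma dag_subset: "dag V D \<Longrightarrow> D' \<subseteq> D \<Longrightarrow> dag V D'"
  by (meson dag_def acyclic_subset subset_trans)

definition polytree :: "'v set \<Rightarrow> ('v \<times> 'v) set \<Rightarrow> bool" where
  "polytree V D \<longleftrightarrow> dag V D \<and> (\<nexists>p. ucycle (skeleton D) p)"

lemma polytree_dag: "polytree V D \<Longrightarrow> dag V D"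
  by (simp add: polytree_def)

lemma polytree_skeleton_subset:
  "polytree V D \<Longrightarrow> dag V D' \<Longrightarrow> skeleton D' \<subseteq> skeleton D \<Longrightarrow> polytree V D'"
  using ucycle_mono[of "skeleton D'" _ "skeleton D"] unfolding polytree_def by blast

lemma polytree_subset: "polytree V D \<Longrightarrow> D' \<subseteq> D \<Longrightarrow> polytree V D'"
  by (meson polytree_skeleton_subset dag_subset polytree_dag skeleton_mono)

lemma polytree_upath_unique:
  assumes "polytree V D" "upath (skeleton D) p" "upath (skeleton D) q" "hd p = hd q" "last p = last q"
  shows "p = q"
  using forest_upath_unique[of "skeleton D" p q] assms unfolding polytree_def by blast

lemma adjacent_not_d_separated:
  assumes "dag V D" "{u, v} \<in> skeleton D" "u \<in> A" "v \<in> B"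
  shows "\<not> d_separated D A B C"
proof -
  have "u \<noteq> v" using assms(2) dag_irrefl[OF assms(1), of u] by (auto simp: skeleton_iff)
  then have "d_connecting D C [u, v]"
    using assms by (auto simp: d_connecting_def upath_iff_successively)
  then show ?thesis using assms(3,4) unfolding d_separated_def by fastforce
qed

text \<open>Paths are unique, so \<open>[u, w, v]\<close> is the only candidate and everything is
  decided at \<open>w\<close>.\<close>

lemma polytree_triple_d_separated:
  assumes D: "polytree V D" "{u, w} \<in> skeleton D" "{v, w} \<in> skeleton D" "u \<noteq> v"
  shows "d_separated D {u} {v} C \<longleftrightarrow>
    \<not> (if collider D u w v then \<exists>c\<in>C. (w, c) \<in> D\<^sup>* else w \<notin> C)"
proof -
  have ne: "u \<noteq> w" "v \<noteq> w"
    using assms dag_irrefl[OF polytree_dag[OF assms(1)]] by (auto simp: skeleton_iff)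
  have up: "upath (skeleton D) [u, w, v]"
    using D ne by (auto simp: upath_iff_successively insert_commute)
  have "d_separated D {u} {v} C \<longleftrightarrow> \<not> d_connecting D C [u, w, v]"
  proof
    assume "d_separated D {u} {v} C"
    then show "\<not> d_connecting D C [u, w, v]" by (force simp: d_separated_def)
  next
    assume nc: "\<not> d_connecting D C [u, w, v]"
    show "d_separated D {u} {v} C"
      unfolding d_separated_def
    proof
      assume "\<exists>p. d_connecting D C p \<and> hd p \<in> {u} \<and> last p \<in> {v}"
      then obtain p where p: "d_connecting D C p" "hd p = u" "last p = v" by auto
      then have "p = [u, w, v]"
        using polytree_upath_unique[OF D(1) _ up] by (auto simp: d_connecting_def)
      then show False using p nc by simp
    qed
  qed
  also have "d_connecting D C [u, w, v] \<longleftrightarrow>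
      (if collider D u w v then \<exists>c\<in>C. (w, c) \<in> D\<^sup>* else w \<notin> C)"
    using up by (auto simp: d_connecting_def less_Suc_eq)
  finally show ?thesis .
qed

lemma upath_skeleton_in:
  assumes "dag V D" "upath (skeleton D) p" "Suc i < length p"
  shows "p ! i \<in> V" "p ! Suc i \<in> V"
proof -
  have "{p ! i, p ! Suc i} \<in> skeleton D" using assms by (auto simp: upath_def)
  then show "p ! i \<in> V" "p ! Suc i \<in> V"
    using assms(1) by (auto simp: skeleton_iff dag_def)
qed

text \<open>The only possible path from \<open>u\<close> to \<open>v\<close> is blocked at its second vertex, by the empty set if
  that vertex is a collider and by its singleton otherwise.\<close>
lemma polytree_nonadjacent_d_separated:
  assumes D: "polytree V D" and uv: "u \<noteq> v" "{u, v} \<notin> skeleton D"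
  obtains C where "C \<subseteq> V" "u \<notin> C" "v \<notin> C" "d_separated D {u} {v} C"
proof (cases "\<exists>p. upath (skeleton D) p \<and> hd p = u \<and> last p = v")
  case False
  then have "d_separated D {u} {v} {}"
    by (auto simp: d_separated_def d_connecting_def)
  then show ?thesis using that by blast
next
  case True
  then obtain p where p: "upath (skeleton D) p" "hd p = u" "last p = v" by blast
  obtain x y r where pr: "p = u # x # y # r"
  proof (cases p)
    case Nil then show ?thesis using p by (auto simp: upath_def)
  next
    case c1: (Cons a p1)
    show ?thesis
    proof (cases p1)
      case Nil then show ?thesis using p c1 uv by auto
    next
      case c2: (Cons b p2)
      show ?thesis
      proof (cases p2)
        case Nil
        then show ?thesis using p c1 c2 uv by (auto simp: upath_iff_successively)
      next
        case (Cons c p3)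
        then show ?thesis using that p c1 c2 by auto
      qed
    qed
  qed
  have xV: "x \<in> V"
    using upath_skeleton_in(2)[OF polytree_dag[OF D] p(1), of 0] pr by simp
  have v: "v \<in> set (y # r)" using p(3) pr last_in_set[of "y # r"] by auto
  have x: "x \<noteq> u" "x \<noteq> v" using p(1) pr v by (auto simp: upath_def)
  define C where "C = (if collider D u x y then {} else {x})"
  have "\<not> d_connecting D C p"
  proof
    assume "d_connecting D C p"
    then have "if collider D (p ! 0) (p ! Suc 0) (p ! Suc (Suc 0))
         then \<exists>c\<in>C. (p ! Suc 0, c) \<in> D\<^sup>*
         else p ! Suc 0 \<notin> C"
      unfolding d_connecting_def using pr by (metis length_Cons zero_less_Suc Suc_less_eq)
    then show False by (auto simp: pr C_def split: if_splits)
  qed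
  then have "d_separated D {u} {v} C"
    using polytree_upath_unique[OF D _ p(1)] p(2,3)
    unfolding d_separated_def d_connecting_def by (metis singletonD)
  moreover have "C \<subseteq> V" "u \<notin> C" "v \<notin> C" using xV x by (auto simp: C_def)
  ultimately show ?thesis using that by blast
qed

section \<open>Embeddings of polytrees\<close>

text \<open>In a forest the two parents of a collider are not adjacent, so colliders are
  v-structures, and for polytrees mutual embedding is the criterion of equal skeletons and equal
  v-structures.\<close>

definition embeds :: "('v \<times> 'v) set \<Rightarrow> ('v \<times> 'v) set \<Rightarrow> bool" where
  "embeds D1 D2 \<longleftrightarrow> skeleton D1 \<subseteq> skeleton D2 \<and>
     (\<forall>u w v. u \<noteq> v \<longrightarrow> {u, w} \<in> skeleton D1 \<longrightarrow> {v, w} \<in> skeleton D1 \<longrightarrow>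
        (collider D1 u w v \<longleftrightarrow> collider D2 u w v))"

lemma embeds_trans: "embeds D1 D2 \<Longrightarrow> embeds D2 D3 \<Longrightarrow> embeds D1 D3"
  unfolding embeds_def by (meson subset_iff)

text \<open>Asymmetry of \<open>D2\<close> gives every edge of \<open>D1\<close> a single direction
  in \<open>D2\<close>; an additional reversed edge could create a collider.\<close>

lemma embeds_subset:
  assumes "dag V D2" "D1 \<subseteq> D2"
  shows "embeds D1 D2"
  unfolding embeds_def
proof (intro conjI allI impI)
  show "skeleton D1 \<subseteq> skeleton D2" using assms skeleton_mono by blast
  fix u w v
  assume "u \<noteq> v" "{u, w} \<in> skeleton D1" "{v, w} \<in> skeleton D1"
  then have "(u, w) \<in> D1 \<or> (w, u) \<in> D1" "(v, w) \<in> D1 \<or> (w, v) \<in> D1"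
    by (auto simp: skeleton_iff)
  then show "collider D1 u w v \<longleftrightarrow> collider D2 u w v"
    using assms dag_asym[OF assms(1)] unfolding collider_def by blast
qed

text \<open>Embeddings preserve all edges that leave a vertex whose incoming edge they preserve, as
  otherwise these two edges would form a new collider.\<close>
lemma embeds_descendant:
  assumes "dag V D1" "embeds D1 D2" "(w, c) \<in> D1\<^sup>*" "(u, w) \<in> D1" "(u, w) \<in> D2"
  shows "(w, c) \<in> D2\<^sup>*"
  using assms(3-5)
proof (induction arbitrary: u rule: converse_rtrancl_induct)
  case base
  then show ?case by simp
next
  case (step w x)
  have "u \<noteq> x" "(x, w) \<notin> D1" using dag_asym[OF assms(1)] step by auto
  moreover have "{u, w} \<in> skeleton D1" "{x, w} \<in> skeleton D1"
    using step by (auto simp: skeleton_iff)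
  ultimately have "\<not> collider D2 u w x" "{x, w} \<in> skeleton D2"
    using assms(2) unfolding embeds_def by (auto simp: collider_def)
  then have "(w, x) \<in> D2" using step.prems by (auto simp: collider_def skeleton_iff)
  then show ?case using step by (meson converse_rtrancl_into_rtrancl)
qed

text \<open>At a collider the incoming edge has the same direction in both graphs, which is what
  \<open>embeds_descendant\<close> needs to carry over the directed path to
  \<open>C\<close>.\<close>

lemma embeds_d_connecting:
  assumes "dag V D1" "embeds D1 D2" "d_connecting D1 C p"
  shows "d_connecting D2 C p"
  unfolding d_connecting_def
proof (intro conjI allI impI)
  have up: "upath (skeleton D1) p" using assms(3) by (simp add: d_connecting_def)
  then show "upath (skeleton D2) p" using assms(2) upath_mono by (auto simp: embeds_def)
  fix i assume i: "Suc (Suc i) < length p"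
  let ?u = "p ! i" and ?w = "p ! Suc i" and ?v = "p ! Suc (Suc i)"
  have "?u \<noteq> ?v" "{?u, ?w} \<in> skeleton D1" "{?v, ?w} \<in> skeleton D1"
    using up i by (auto simp: upath_def nth_eq_iff_index_eq insert_commute)
  then have c: "collider D1 ?u ?w ?v \<longleftrightarrow> collider D2 ?u ?w ?v"
    using assms(2) by (auto simp: embeds_def)
  have d: "if collider D1 ?u ?w ?v then \<exists>c\<in>C. (?w, c) \<in> D1\<^sup>* else ?w \<notin> C"
    using assms(3) i by (simp add: d_connecting_def)
  show "if collider D2 ?u ?w ?v then \<exists>c\<in>C. (?w, c) \<in> D2\<^sup>* else ?w \<notin> C"
  proof (cases "collider D2 ?u ?w ?v")
    case True
    then have "(?u, ?w) \<in> D1" "(?u, ?w) \<in> D2" using c by (auto simp: collider_def)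
    then show ?thesis using True c d embeds_descendant[OF assms(1,2)] by auto
  next
    case False
    then show ?thesis using c d by simp
  qed
qed

lemma embeds_d_separated:
  "dag V D1 \<Longrightarrow> embeds D1 D2 \<Longrightarrow> d_separated D2 A B C \<Longrightarrow> d_separated D1 A B C"
  using embeds_d_connecting unfolding d_separated_def by blast

section \<open>Mutual embedding and Markov equivalence\<close>

lemma embeds_markov_equivalent:
  assumes "dag V D1" "dag V D2" "embeds D1 D2" "embeds D2 D1"
  shows "markov_equivalent V D1 D2"
  using embeds_d_separated[OF assms(1,3)] embeds_d_separated[OF assms(2,4)]
  unfolding markov_equivalent_def by blast

text \<open>Adjacent vertices are never separated, whereas nonadjacent ones in a polytree are
  separated by some set. The inclusion makes \<open>D'\<close> a polytree too, after which the roles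
  can be exchanged.\<close>

lemma markov_equivalent_skeleton_subset:
  assumes "polytree V D" "dag V D'" "markov_equivalent V D D'"
  shows "skeleton D' \<subseteq> skeleton D"
proof
  fix e assume e: "e \<in> skeleton D'"
  then obtain u v where uv: "e = {u, v}" "(u, v) \<in> D'" by (auto simp: skeleton_def)
  have ne: "u \<noteq> v" "u \<in> V" "v \<in> V"
    using uv dag_irrefl[OF assms(2)] assms(2) by (auto simp: dag_def)
  show "e \<in> skeleton D"
  proof (rule ccontr)
    assume "e \<notin> skeleton D"
    then obtain C where C: "C \<subseteq> V" "u \<notin> C" "v \<notin> C" "d_separated D {u} {v} C"
      using polytree_nonadjacent_d_separated[OF assms(1) ne(1)] uv by blast
    then have "disjoint_triple V {u} {v} C" using ne by (auto simp: disjoint_triple_def)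
    then have "d_separated D' {u} {v} C"
      using assms(3) C(4) by (simp add: markov_equivalent_def)
    then show False
      using adjacent_not_d_separated[OF assms(2), of u v "{u}" "{v}" C] e uv by auto
  qed
qed

lemma markov_equivalent_sym: "markov_equivalent V D D' \<longleftrightarrow> markov_equivalent V D' D"
  by (auto simp: markov_equivalent_def)

text \<open>For two edges meeting in \<open>w\<close>, the empty set separates the outer ends
  exactly when \<open>w\<close> is a collider, so colliders can be read off the separations.\<close>

lemma markov_equivalent_embeds:
  assumes D: "polytree V D" "dag V D'" "markov_equivalent V D D'"
  shows "embeds D D'" and "embeds D' D"
proof -
  have sub: "skeleton D' \<subseteq> skeleton D"
    using markov_equivalent_skeleton_subset[OF D] .
  have D': "polytree V D'" using polytree_skeleton_subset D sub by blast
  have sk: "skeleton D' = skeleton D"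
    using sub markov_equivalent_skeleton_subset[OF D' polytree_dag[OF D(1)]] D(3)
      markov_equivalent_sym by blast
  have "collider D u w v \<longleftrightarrow> collider D' u w v"
    if uv: "u \<noteq> v" "{u, w} \<in> skeleton D" "{v, w} \<in> skeleton D" for u w v
  proof -
    have "u \<in> V" "v \<in> V"
      using uv polytree_dag[OF D(1)] by (auto simp: skeleton_iff dag_def)
    then have "disjoint_triple V {u} {v} {}" using uv by (auto simp: disjoint_triple_def)
    then have "d_separated D {u} {v} {} \<longleftrightarrow> d_separated D' {u} {v} {}"
      using D(3) by (simp add: markov_equivalent_def)
    then show ?thesis
      using polytree_triple_d_separated[OF D(1) uv(2,3,1), of "{}"]
        polytree_triple_d_separated[OF D', of u w v "{}"] uv sk by (simp split: if_splits)
  qed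
  then show "embeds D D'" "embeds D' D" using sk by (auto simp: embeds_def)
qed

lemma markov_class_eqI:
  assumes "markov_equivalent V D D'"
  shows "markov_class V D = markov_class V D'"
  using assms by (auto simp: markov_class_def markov_equivalent_def)

section \<open>Polytree CPDAGs\<close>

lemma directed_edges_cpdag_of: "dag V D \<Longrightarrow> directed_edges (cpdag_of V D) \<subseteq> D"
  by (auto simp: cpdag_of_def Let_def markov_class_def markov_equivalent_def)

lemma pdag_skeleton_cpdag_of: "dag V D \<Longrightarrow> pdag_skeleton (cpdag_of V D) = skeleton D"
  using skeleton_mono[OF directed_edges_cpdag_of, of V D]
  by (auto simp: pdag_skeleton_def cpdag_of_def Let_def)

lemma cpdag_of_cong:
  assumes "dag V D1" "dag V D2" "embeds D1 D2" "embeds D2 D1"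
  shows "cpdag_of V D1 = cpdag_of V D2"
proof -
  have "skeleton D1 = skeleton D2" using assms by (auto simp: embeds_def)
  moreover have "markov_class V D1 = markov_class V D2"
    using markov_class_eqI embeds_markov_equivalent assms by metis
  ultimately show ?thesis by (simp add: cpdag_of_def)
qed

text \<open>Recovers the class from its CPDAG: the edges of a collider have the same direction in
  the whole class, hence are directed in the CPDAG, hence belong to every DAG with this
  CPDAG.\<close>

lemma cpdag_of_eq_embeds:
  fixes D1 D2 :: "('v \<times> 'v) set"
  assumes "polytree V D1" "dag V D2" "cpdag_of V D1 = cpdag_of V D2"
  shows "embeds D1 D2"
proof -
  have sk: "skeleton D1 = skeleton D2"
    using pdag_skeleton_cpdag_of assms polytree_dag by metis
  have P2: "polytree V D2" using polytree_skeleton_subset assms sk by blast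
  have col: "collider D' u w v"
    if "polytree V D" "cpdag_of V D = cpdag_of V D'" "dag V D'" "collider D u w v" "u \<noteq> v"
    for D D' u w v
  proof -
    have "collider D'' u w v" if "D'' \<in> markov_class V D" for D''
      using markov_equivalent_embeds[OF \<open>polytree V D\<close>, of D''] that \<open>collider D u w v\<close> \<open>u \<noteq> v\<close>
      by (auto simp: markov_class_def embeds_def skeleton_iff collider_def)
    then have "{(u, w), (v, w)} \<subseteq> directed_edges (cpdag_of V D)"
      by (auto simp: cpdag_of_def collider_def)
    then show ?thesis
      using directed_edges_cpdag_of[OF \<open>dag V D'\<close>] \<open>cpdag_of V D = cpdag_of V D'\<close>
      by (auto simp: collider_def)
  qed
  show ?thesis
    unfolding embeds_def
  proof (intro conjI allI impI iffI)
    show "skeleton D1 \<subseteq> skeleton D2" using sk by simp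
    fix u w v :: 'v assume uv: "u \<noteq> v"
    show "collider D2 u w v" if "collider D1 u w v"
      using col[OF assms(1,3,2) that uv] .
    show "collider D1 u w v" if "collider D2 u w v"
      using col[OF P2 assms(3)[symmetric] polytree_dag[OF assms(1)] that uv] .
  qed
qed

lemma polytree_cpdags_iff:
  "G \<in> polytree_cpdags V \<longleftrightarrow> (\<exists>D. polytree V D \<and> G = cpdag_of V D)"
  by (auto simp: polytree_cpdags_def cpdags_def polytree_def pdag_skeleton_cpdag_of)

lemma dags_of_cpdag_of:
  assumes "polytree V D"
  shows "D' \<in> dags_of V (cpdag_of V D) \<longleftrightarrow> dag V D' \<and> embeds D D' \<and> embeds D' D"
proof
  assume "D' \<in> dags_of V (cpdag_of V D)"
  then have D': "dag V D'" "cpdag_of V D' = cpdag_of V D" by (auto simp: dags_of_def)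
  then have 1: "embeds D D'" using cpdag_of_eq_embeds[OF assms] by simp
  have "skeleton D' = skeleton D"
    using D' pdag_skeleton_cpdag_of polytree_dag[OF assms] by metis
  then have "polytree V D'" using polytree_skeleton_subset[OF assms D'(1)] by blast
  then have "embeds D' D" using cpdag_of_eq_embeds D' polytree_dag[OF assms] by blast
  then show "dag V D' \<and> embeds D D' \<and> embeds D' D" using 1 D' by blast
next
  assume "dag V D' \<and> embeds D D' \<and> embeds D' D"
  then show "D' \<in> dags_of V (cpdag_of V D)"
    using cpdag_of_cong[of V D' D] polytree_dag[OF assms] by (auto simp: dags_of_def)
qed

text \<open>The witness is the skeleton of \<open>D1\<close> oriented as in \<open>D2\<close>: its
  colliders are those of \<open>D2\<close> on these edges, which by the embedding are those of
  \<open>D1\<close>.\<close>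

lemma embeds_obtain_subset:
  assumes "polytree V D1" "dag V D2" "embeds D1 D2"
  obtains D where "D \<in> dags_of V (cpdag_of V D1)" "D \<subseteq> D2"
proof
  define D where "D = {(u, v) \<in> D2. {u, v} \<in> skeleton D1}"
  show sub: "D \<subseteq> D2" by (auto simp: D_def)
  then have dag: "dag V D" using dag_subset assms by blast
  have eq: "skeleton D = skeleton D1"
  proof
    show "skeleton D \<subseteq> skeleton D1" by (auto simp: D_def skeleton_def)
    show "skeleton D1 \<subseteq> skeleton D"
    proof
      fix e assume e: "e \<in> skeleton D1"
      then have "e \<in> skeleton D2" using assms(3) by (auto simp: embeds_def)
      then obtain u v where "e = {u, v}" "(u, v) \<in> D2" by (auto simp: skeleton_def)
      then show "e \<in> skeleton D" using e by (auto simp: D_def skeleton_def)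
    qed
  qed
  have "embeds D D2" using embeds_subset[OF assms(2) sub] .
  then have "embeds D D1" "embeds D1 D"
    using assms(3) eq by (auto simp: embeds_def)
  then show "D \<in> dags_of V (cpdag_of V D1)"
    using dags_of_cpdag_of[OF assms(1)] dag by blast
qed

lemma dag_finite: "finite V \<Longrightarrow> dag V D \<Longrightarrow> finite D"
  using finite_subset[of D "V \<times> V"] by (simp add: dag_def)

lemma card_skeleton:
  assumes "dag V D"
  shows "card (skeleton D) = card D"
proof -
  have "skeleton D = (\<lambda>(u, v). {u, v}) ` D" by (auto simp: skeleton_def)
  moreover have "inj_on (\<lambda>(u, v). {u, v}) D"
    using dag_asym[OF assms] by (auto simp: inj_on_def doubleton_eq_iff)
  ultimately show ?thesis by (simp add: card_image)
qed

text \<open>The directed edges form a DAG, so forgetting directions does not change their number,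
  and the undirected edges are the rest of the skeleton.\<close>

lemma num_edges_cpdag_of:
  assumes "finite V" "dag V D"
  shows "num_edges (cpdag_of V D) = card D"
proof -
  let ?S = "directed_edges (cpdag_of V D)"
  have S: "?S \<subseteq> D" "dag V ?S" using directed_edges_cpdag_of dag_subset assms by blast+
  have fin: "finite (skeleton D)"
  proof -
    have "skeleton D = (\<lambda>(u, v). {u, v}) ` D" by (auto simp: skeleton_def)
    then show ?thesis using dag_finite[OF assms] by simp
  qed
  have "undirected_edges (cpdag_of V D) = skeleton D - skeleton ?S"
    by (simp add: cpdag_of_def Let_def)
  then have "num_edges (cpdag_of V D) = card (skeleton ?S) + card (skeleton D - skeleton ?S)"
    by (simp add: num_edges_def card_skeleton[OF S(2)])
  also have "\<dots> = card (skeleton D)"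
    using skeleton_mono[OF S(1)] fin
    by (metis card_Diff_subset card_mono finite_subset le_add_diff_inverse)
  finally show ?thesis using card_skeleton[OF assms(2)] by simp
qed

section \<open>Down-up paths in lower semimodular posets\<close>

text \<open>As a relation, so that paths with \<open>n\<close> steps become \<open>n\<close>-th
  relational powers and can be concatenated without list indices.\<close>

definition cover :: "'g rel \<Rightarrow> 'g rel" where
  "cover r = {(x, y). covered_by r x y}"

lemma cover_Field: "(x, y) \<in> cover r \<Longrightarrow> x \<in> Field r" "(x, y) \<in> cover r \<Longrightarrow> y \<in> Field r"
  by (auto simp: cover_def covered_by_def Field_def)

lemma path_of_fun:
  fixes n :: nat
  assumes "f 0 = s" "f n = t" "s \<in> Field r"
    "\<And>i. i < n \<Longrightarrow> (f i, f (Suc i)) \<in> cover r \<or> (f (Suc i), f i) \<in> cover r"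
  defines "p \<equiv> map f [0..<Suc n]"
  shows "p \<noteq> []" "set p \<subseteq> Field r" "hd p = s" "last p = t" "length p = Suc n"
    "\<And>i. i \<le> n \<Longrightarrow> p ! i = f i"
proof -
  show "length p = Suc n" by (simp add: p_def)
  show "p ! i = f i" if "i \<le> n" for i
    using that by (auto simp: p_def simp del: upt_Suc)
  show "p \<noteq> []" by (simp add: p_def)
  show "hd p = s" "last p = t"
    using assms(1,2) by (simp_all add: p_def hd_map last_map del: upt_Suc)
  have "f i \<in> Field r" if "i \<le> n" for i
  proof (cases i)
    case 0
    then show ?thesis using assms by simp
  next
    case (Suc j)
    then show ?thesis using assms(4)[of j] that cover_Field by fastforce
  qed
  then show "set p \<subseteq> Field r" by (auto simp: p_def simp del: upt_Suc)
qed

lemma relpow_poset_path: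
  assumes "(s, t) \<in> (cover r \<union> (cover r)\<inverse>) ^^ n" "s \<in> Field r"
  obtains p where "poset_path r s p t" "length p = Suc n"
proof -
  obtain f where f: "f 0 = s" "f n = t" "\<And>i. i < n \<Longrightarrow> (f i, f (Suc i)) \<in> cover r \<union> (cover r)\<inverse>"
    using assms(1) by (auto simp: relpow_fun_conv)
  then have st: "\<And>i. i < n \<Longrightarrow> (f i, f (Suc i)) \<in> cover r \<or> (f (Suc i), f i) \<in> cover r" by auto
  note p = path_of_fun[OF f(1,2) assms(2) st]
  have "poset_path r s (map f [0..<Suc n]) t"
    unfolding poset_path_def using p st by (auto simp: cover_def simp del: upt_Suc)
  then show ?thesis using that p(5) by blast
qed

lemma poset_path_relpow:
  assumes "poset_path r s p t"
  shows "(s, t) \<in> (cover r \<union> (cover r)\<inverse>) ^^ (length p - 1)"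
  unfolding relpow_fun_conv
proof (intro exI[of _ "\<lambda>i. p ! i"] conjI allI impI)
  show "p ! 0 = s" "p ! (length p - 1) = t"
    using assms by (auto simp: poset_path_def hd_conv_nth last_conv_nth)
  fix i assume "i < length p - 1"
  then have "Suc i < length p" by simp
  then show "(p ! i, p ! Suc i) \<in> cover r \<union> (cover r)\<inverse>"
    using assms by (auto simp: poset_path_def cover_def)
qed

lemma relpow_down_up_path:
  assumes "(s, m) \<in> ((cover r)\<inverse>) ^^ i" "(m, t) \<in> cover r ^^ j" "s \<in> Field r"
  obtains p where "down_up_path r s p t" "length p = Suc (i + j)"
proof -
  obtain f where f: "f 0 = s" "f i = m" "\<And>k. k < i \<Longrightarrow> (f (Suc k), f k) \<in> cover r"
    using assms(1) by (auto simp: relpow_fun_conv)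
  obtain g where g: "g 0 = m" "g j = t" "\<And>k. k < j \<Longrightarrow> (g k, g (Suc k)) \<in> cover r"
    using assms(2) by (auto simp: relpow_fun_conv)
  define h where "h k = (if k \<le> i then f k else g (k - i))" for k
  have down: "(h (Suc k), h k) \<in> cover r" if "k < i" for k
    using that f(3) by (auto simp: h_def)
  have up: "(h k, h (Suc k)) \<in> cover r" if k: "i \<le> k" "k < i + j" for k
  proof -
    have "Suc k - i = Suc (k - i)" using k by simp
    moreover have "h k = g (k - i)" using k f(2) g(1) by (auto simp: h_def)
    ultimately show ?thesis using g(3)[of "k - i"] k by (simp add: h_def)
  qed
  have "h 0 = s" using f by (simp add: h_def)
  moreover have "h (i + j) = t" using f g by (auto simp: h_def)
  moreover have "\<And>k. k < i + j \<Longrightarrow> (h k, h (Suc k)) \<in> cover r \<or> (h (Suc k), h k) \<in> cover r"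
    using down up by (meson not_less)
  ultimately have p: "map h [0..<Suc (i + j)] \<noteq> []" "set (map h [0..<Suc (i + j)]) \<subseteq> Field r"
    "hd (map h [0..<Suc (i + j)]) = s" "last (map h [0..<Suc (i + j)]) = t"
    "length (map h [0..<Suc (i + j)]) = Suc (i + j)"
    "\<And>k. k \<le> i + j \<Longrightarrow> map h [0..<Suc (i + j)] ! k = h k"
    using path_of_fun[of h s "i + j" t r] assms(3) by blast+
  have "down_up_path r s (map h [0..<Suc (i + j)]) t"
    unfolding down_up_path_def
  proof (intro conjI exI[of _ i] allI impI)
    fix k assume k: "Suc k < length (map h [0..<Suc (i + j)])"
    then have "k < i + j" using p(5) by simp
    then show "if k < i
        then covered_by r (map h [0..<Suc (i + j)] ! Suc k) (map h [0..<Suc (i + j)] ! k)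
        else covered_by r (map h [0..<Suc (i + j)] ! k) (map h [0..<Suc (i + j)] ! Suc k)"
      using p(6)[of k] p(6)[of "Suc k"] down[of k] up[of k] unfolding cover_def by auto
  qed (use p in auto)
  then show ?thesis using that p(5) by blast
qed

lemma down_up_path_poset_path: "down_up_path r s p t \<Longrightarrow> poset_path r s p t"
  unfolding down_up_path_def poset_path_def by metis

text \<open>The final down step is moved to the left past the up steps. Each exchange uses lower
  semimodularity and preserves the length; if the last up step and the down step are inverse to each
  other, they cancel and the path gets shorter.\<close>

lemma up_then_down:
  assumes "lower_semimodular r" "(m, z) \<in> cover r ^^ j" "(t, z) \<in> cover r"
  shows "\<exists>i' j' m'. i' + j' \<le> Suc j \<and> (m, m') \<in> ((cover r)\<inverse>) ^^ i' \<and> (m', t) \<in> cover r ^^ j'"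
  using assms(2,3)
proof (induction j arbitrary: z t)
  case 0
  then show ?case by (intro exI[of _ 1] exI[of _ 0] exI[of _ t]) auto
next
  case (Suc j)
  obtain y where y: "(m, y) \<in> cover r ^^ j" "(y, z) \<in> cover r"
    using Suc.prems(1) by auto
  show ?case
  proof (cases "y = t")
    case True
    then show ?thesis using y by (intro exI[of _ 0] exI[of _ j] exI[of _ m]) auto
  next
    case False
    then obtain w where w: "(w, y) \<in> cover r" "(w, t) \<in> cover r"
      using assms(1) y(2) Suc.prems(2) unfolding lower_semimodular_def cover_def by blast
    obtain i' j' m' where "i' + j' \<le> Suc j" "(m, m') \<in> ((cover r)\<inverse>) ^^ i'" "(m', w) \<in> cover r ^^ j'"
      using Suc.IH[OF y(1) w(1)] by blast
    then show ?thesis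
      using w(2) by (intro exI[of _ i'] exI[of _ "Suc j'"] exI[of _ m']) auto
  qed
qed

lemma relpow_down_up:
  assumes "lower_semimodular r" "(s, t) \<in> (cover r \<union> (cover r)\<inverse>) ^^ n"
  shows "\<exists>i j m. i + j \<le> n \<and> (s, m) \<in> ((cover r)\<inverse>) ^^ i \<and> (m, t) \<in> cover r ^^ j"
  using assms(2)
proof (induction n arbitrary: t)
  case 0
  then show ?case by (intro exI[of _ 0] exI[of _ s]) auto
next
  case (Suc n)
  obtain u where u: "(s, u) \<in> (cover r \<union> (cover r)\<inverse>) ^^ n" "(u, t) \<in> cover r \<union> (cover r)\<inverse>"
    using Suc.prems by auto
  obtain i j m where m: "i + j \<le> n" "(s, m) \<in> ((cover r)\<inverse>) ^^ i" "(m, u) \<in> cover r ^^ j"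
    using Suc.IH[OF u(1)] by blast
  show ?case
  proof (cases "(u, t) \<in> cover r")
    case True
    then show ?thesis using m by (intro exI[of _ i] exI[of _ "Suc j"] exI[of _ m]) auto
  next
    case False
    then have "(t, u) \<in> cover r" using u(2) by auto
    from up_then_down[OF assms(1) m(3) this]
    obtain i' j' m' where m': "i' + j' \<le> Suc j" "(m, m') \<in> ((cover r)\<inverse>) ^^ i'" "(m', t) \<in> cover r ^^ j'"
      by blast
    have "(s, m') \<in> ((cover r)\<inverse>) ^^ (i + i')"
      using m(2) m'(2) by (auto simp: relpow_add)
    then show ?thesis using m' m(1) by (intro exI[of _ "i + i'"] exI[of _ j'] exI[of _ m']) auto
  qed
qed

lemma poset_dist_eq_down_up_dist:
  assumes "lower_semimodular r" "s \<in> Field r"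
  shows "poset_dist r s t = down_up_dist r s t"
proof (rule antisym)
  show "poset_dist r s t \<le> down_up_dist r s t"
    unfolding poset_dist_def down_up_dist_def
    by (intro Inf_superset_mono) (auto dest: down_up_path_poset_path)
  show "down_up_dist r s t \<le> poset_dist r s t"
    unfolding poset_dist_def
  proof (rule Inf_greatest, clarify)
    fix p assume "poset_path r s p t"
    from relpow_down_up[OF assms(1) poset_path_relpow[OF this]]
    obtain i j m where m: "i + j \<le> length p - 1" "(s, m) \<in> ((cover r)\<inverse>) ^^ i" "(m, t) \<in> cover r ^^ j"
      by blast
    obtain q where q: "down_up_path r s q t" "length q = Suc (i + j)"
      using relpow_down_up_path[OF m(2,3) assms(2)] by blast
    then have "down_up_dist r s t \<le> enat (length q - 1)"
      unfolding down_up_dist_def by (intro Inf_lower CollectI exI[of _ q] conjI refl)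
    also have "\<dots> \<le> enat (length p - 1)" using q(2) m(1) by simp
    finally show "down_up_dist r s t \<le> enat (length p - 1)" .
  qed
qed

section \<open>The poset of polytree CPDAGs\<close>

definition subgraph_order :: "'v set \<Rightarrow> 'v pdag rel" where
  "subgraph_order V = {(G1, G2). G1 \<in> polytree_cpdags V \<and> G2 \<in> polytree_cpdags V \<and>
     (\<exists>D1\<in>dags_of V G1. \<exists>D2\<in>dags_of V G2. D1 \<subseteq> D2)}"

text \<open>Makes the choice of representatives immaterial; transitivity and antisymmetry of the
  order are then read off from embeddings.\<close>

lemma subgraph_order_cpdag_of:
  assumes "polytree V D1" "polytree V D2"
  shows "(cpdag_of V D1, cpdag_of V D2) \<in> subgraph_order V \<longleftrightarrow> embeds D1 D2"
proof
  assume "(cpdag_of V D1, cpdag_of V D2) \<in> subgraph_order V"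
  then obtain E1 E2 where E: "E1 \<in> dags_of V (cpdag_of V D1)" "E2 \<in> dags_of V (cpdag_of V D2)" "E1 \<subseteq> E2"
    unfolding subgraph_order_def by auto
  then have "embeds D1 E1" "embeds E2 D2" "dag V E2"
    using dags_of_cpdag_of assms by blast+
  then show "embeds D1 D2" using embeds_trans embeds_subset E(3) by metis
next
  assume "embeds D1 D2"
  then obtain D where D: "D \<in> dags_of V (cpdag_of V D1)" "D \<subseteq> D2"
    using embeds_obtain_subset assms polytree_dag by blast
  moreover have "D2 \<in> dags_of V (cpdag_of V D2)"
    using assms by (simp add: dags_of_def polytree_dag)
  ultimately show "(cpdag_of V D1, cpdag_of V D2) \<in> subgraph_order V"
    using assms unfolding subgraph_order_def polytree_cpdags_iff by blast
qed

lemma subgraph_orderI: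
  "polytree V D \<Longrightarrow> D' \<subseteq> D \<Longrightarrow> (cpdag_of V D', cpdag_of V D) \<in> subgraph_order V"
  using subgraph_order_cpdag_of[of V D' D] polytree_subset embeds_subset polytree_dag by metis

text \<open>The representative of the upper element can be prescribed, so a descending chain becomes
  a chain of nested edge sets inside one DAG.\<close>

lemma subgraph_orderE:
  assumes "(G1, cpdag_of V D) \<in> subgraph_order V" "polytree V D"
  obtains D1 where "D1 \<subseteq> D" "polytree V D1" "G1 = cpdag_of V D1"
proof -
  obtain E where E: "polytree V E" "G1 = cpdag_of V E"
    using assms(1) unfolding subgraph_order_def polytree_cpdags_iff by blast
  then have "embeds E D" using subgraph_order_cpdag_of assms by blast
  then obtain D1 where "D1 \<in> dags_of V G1" "D1 \<subseteq> D"
    using embeds_obtain_subset[OF E(1) polytree_dag[OF assms(2)]] E(2) by metis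
  then show ?thesis using that polytree_subset[OF assms(2)] by (simp add: dags_of_def)
qed

lemma refl_subgraph_order: "refl_on (polytree_cpdags V) (subgraph_order V)"
  using subgraph_orderI[OF _ subset_refl]
  by (auto simp: refl_on_def polytree_cpdags_iff)

lemma Field_subgraph_order: "Field (subgraph_order V) = polytree_cpdags V"
proof
  show "Field (subgraph_order V) \<subseteq> polytree_cpdags V"
    by (auto simp: subgraph_order_def Field_def)
  show "polytree_cpdags V \<subseteq> Field (subgraph_order V)"
    using refl_subgraph_order[of V] unfolding refl_on_def Field_def by blast
qed

lemma partial_order_subgraph_order: "partial_order_on (polytree_cpdags V) (subgraph_order V)"
  unfolding partial_order_on_def preorder_on_def
proof (intro conjI)
  show "refl_on (polytree_cpdags V) (subgraph_order V)" by (rule refl_subgraph_order)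
  show "subgraph_order V \<subseteq> polytree_cpdags V \<times> polytree_cpdags V"
    by (auto simp: subgraph_order_def)
  have pt: "\<exists>D. polytree V D \<and> G = cpdag_of V D" if "(G, G') \<in> subgraph_order V \<or> (G', G) \<in> subgraph_order V" for G G'
    using that by (auto simp: subgraph_order_def polytree_cpdags_iff)
  show "trans (subgraph_order V)"
  proof (rule transI)
    fix x y z assume xy: "(x, y) \<in> subgraph_order V" and yz: "(y, z) \<in> subgraph_order V"
    obtain X Y Z where D: "polytree V X" "x = cpdag_of V X" "polytree V Y" "y = cpdag_of V Y"
      "polytree V Z" "z = cpdag_of V Z"
      using pt xy yz by metis
    then have "embeds X Y" "embeds Y Z" using xy yz subgraph_order_cpdag_of by blast+
    then show "(x, z) \<in> subgraph_order V"
      using D subgraph_order_cpdag_of embeds_trans by metis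
  qed
  show "antisym (subgraph_order V)"
  proof (rule antisymI)
    fix x y assume xy: "(x, y) \<in> subgraph_order V" "(y, x) \<in> subgraph_order V"
    obtain X Y where D: "polytree V X" "x = cpdag_of V X" "polytree V Y" "y = cpdag_of V Y"
      using pt xy by metis
    then have "embeds X Y" "embeds Y X" using xy subgraph_order_cpdag_of by blast+
    then show "x = y" using D cpdag_of_cong polytree_dag by metis
  qed
qed

section \<open>The least element, covers, lower semimodularity and grading\<close>

lemma polytree_empty: "polytree V {}"
  by (auto simp: polytree_def dag_def acyclic_def skeleton_def ucycle_def)

lemma cpdag_of_empty: "cpdag_of V {} = empty_pdag"
proof -
  have "directed_edges (cpdag_of V {}) = {}"
    using directed_edges_cpdag_of[OF polytree_dag[OF polytree_empty]] by blast
  then show ?thesis by (auto simp: cpdag_of_def empty_pdag_def Let_def skeleton_def)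
qed

lemma empty_polytree_cpdag: "empty_pdag \<in> polytree_cpdags V"
  using polytree_empty cpdag_of_empty polytree_cpdags_iff by metis

lemma empty_least: "G \<in> polytree_cpdags V \<Longrightarrow> (empty_pdag, G) \<in> subgraph_order V"
  using subgraph_orderI[of V _ "{}"] cpdag_of_empty[of V] by (auto simp: polytree_cpdags_iff)

text \<open>If the lower element lies in \<open>D\<close> and lacks the edge \<open>e\<close>, then
  \<open>D - {e}\<close> lies between the two and has fewer edges than \<open>D\<close>, so a cover
  must be equal to it. Conversely, an element strictly between would have a number of edges strictly
  between \<open>card D - 1\<close> and \<open>card D\<close>.\<close>

lemma covered_by_subgraph_order:
  assumes "finite V" "polytree V D"
  shows "covered_by (subgraph_order V) G (cpdag_of V D) \<longleftrightarrow> (\<exists>e\<in>D. G = cpdag_of V (D - {e}))"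
    (is "?cov \<longleftrightarrow> _")
proof -
  have fin: "finite D" using dag_finite assms polytree_dag by blast
  have edges: "num_edges (cpdag_of V D') = card D'" if "polytree V D'" for D'
    using num_edges_cpdag_of assms(1) that polytree_dag by blast
  show ?thesis
  proof
    assume cov: ?cov
    then obtain D1 where D1: "D1 \<subseteq> D" "polytree V D1" "G = cpdag_of V D1"
      using subgraph_orderE assms(2) unfolding covered_by_def by metis
    have "D1 \<noteq> D" using cov D1(3) by (auto simp: covered_by_def)
    then obtain e where e: "e \<in> D" "e \<notin> D1" using D1 by blast
    have pe: "polytree V (D - {e})" using polytree_subset assms by blast
    have "(G, cpdag_of V (D - {e})) \<in> subgraph_order V"
      unfolding D1(3) using subgraph_orderI[OF pe] D1 e by blast
    moreover have "(cpdag_of V (D - {e}), cpdag_of V D) \<in> subgraph_order V"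
      using subgraph_orderI assms(2) by blast
    moreover have "cpdag_of V (D - {e}) \<noteq> cpdag_of V D"
      using edges[OF pe] edges[OF assms(2)] e fin by (metis card_Diff1_less less_irrefl)
    ultimately have "G = cpdag_of V (D - {e})"
      using cov unfolding covered_by_def by blast
    then show "\<exists>e\<in>D. G = cpdag_of V (D - {e})" using e by blast
  next
    assume "\<exists>e\<in>D. G = cpdag_of V (D - {e})"
    then obtain e where e: "e \<in> D" "G = cpdag_of V (D - {e})" by blast
    have pe: "polytree V (D - {e})" using polytree_subset assms by blast
    have nG: "num_edges G = card D - 1" using edges[OF pe] e fin by simp
    show ?cov
      unfolding covered_by_def
    proof (intro conjI notI)
      show "(G, cpdag_of V D) \<in> subgraph_order V"
        using subgraph_orderI assms(2) e(2) by blast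
      show "False" if "G = cpdag_of V D"
        using that nG edges[OF assms(2)] e(1) fin by (metis card_Diff1_less card_Diff_singleton less_irrefl)
      show False if "\<exists>z. (G, z) \<in> subgraph_order V \<and> G \<noteq> z \<and>
          (z, cpdag_of V D) \<in> subgraph_order V \<and> z \<noteq> cpdag_of V D"
      proof -
        obtain z where z: "(G, z) \<in> subgraph_order V" "G \<noteq> z"
          "(z, cpdag_of V D) \<in> subgraph_order V" "z \<noteq> cpdag_of V D" using \<open>\<exists>z. _ z\<close> by blast
        obtain Z where Z: "Z \<subseteq> D" "polytree V Z" "z = cpdag_of V Z"
          using subgraph_orderE[OF z(3) assms(2)] by blast
        obtain X where X: "X \<subseteq> Z" "polytree V X" "G = cpdag_of V X"
          using subgraph_orderE[OF z(1)[unfolded Z(3)] Z(2)] by blast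
        have "X \<subset> Z" "Z \<subset> D" using X Z z by auto
        then have "card X < card Z" "card Z < card D"
          using psubset_card_mono finite_subset[OF Z(1) fin] fin by blast+
        then show False using nG edges[OF X(2)] X(3) by simp
      qed
    qed
  qed
qed

lemma covered_by_subgraph_orderE:
  assumes "finite V" "covered_by (subgraph_order V) G1 G2"
  obtains D where "polytree V D" "G2 = cpdag_of V D"
  using assms(2) that unfolding covered_by_def subgraph_order_def polytree_cpdags_iff by blast

lemma lower_semimodular_subgraph_order:
  assumes "finite V"
  shows "lower_semimodular (subgraph_order V)"
  unfolding lower_semimodular_def
proof (intro allI impI, elim conjE)
  fix x y z
  assume xz: "covered_by (subgraph_order V) x z" and yz: "covered_by (subgraph_order V) y z"
    and xy: "x \<noteq> y"
  obtain D where D: "polytree V D" "z = cpdag_of V D"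
    using covered_by_subgraph_orderE assms xz by blast
  \<comment> \<open>One representative \<open>D\<close> serves both lower covers, so the two
    removals take place in the same DAG.\<close>
  obtain e f where ef: "e \<in> D" "x = cpdag_of V (D - {e})" "f \<in> D" "y = cpdag_of V (D - {f})"
    using xz yz covered_by_subgraph_order[OF assms D(1)] unfolding D(2) by blast
  have pt: "polytree V (D - {e})" "polytree V (D - {f})" using polytree_subset D(1) by blast+
  have "e \<noteq> f" using ef xy by blast
  then have "f \<in> D - {e}" "e \<in> D - {f}" using ef by auto
  moreover have "D - {e} - {f} = D - {f} - {e}" by blast
  ultimately have "covered_by (subgraph_order V) (cpdag_of V (D - {e} - {f})) x"
      "covered_by (subgraph_order V) (cpdag_of V (D - {e} - {f})) y"
    using covered_by_subgraph_order[OF assms pt(1)] covered_by_subgraph_order[OF assms pt(2)]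
    unfolding ef(2,4) by metis+
  then show "\<exists>w. covered_by (subgraph_order V) w x \<and> covered_by (subgraph_order V) w y" by blast
qed

text \<open>For connectedness: any two elements are joined through the empty graph.\<close>

lemma cover_rtrancl_empty:
  assumes "finite V" "polytree V D"
  shows "(empty_pdag, cpdag_of V D) \<in> (cover (subgraph_order V))\<^sup>*"
  using dag_finite[OF assms(1) polytree_dag[OF assms(2)]] assms(2)
proof (induction D rule: finite_psubset_induct)
  case (psubset D)
  show ?case
  proof (cases "D = {}")
    case True
    then show ?thesis by (simp add: cpdag_of_empty)
  next
    case False
    then obtain e where e: "e \<in> D" by blast
    have "polytree V (D - {e})" using polytree_subset psubset.prems by blast
    then have "(empty_pdag, cpdag_of V (D - {e})) \<in> (cover (subgraph_order V))\<^sup>*"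
      using psubset.IH[of "D - {e}"] e by blast
    moreover have "(cpdag_of V (D - {e}), cpdag_of V D) \<in> cover (subgraph_order V)"
      using covered_by_subgraph_order[OF assms(1) psubset.prems] e by (auto simp: cover_def)
    ultimately show ?thesis by (rule rtrancl_into_rtrancl)
  qed
qed

lemma graded_subgraph_order:
  assumes "finite V"
  shows "graded_with_rank (subgraph_order V) num_edges"
  unfolding graded_with_rank_def
proof (intro conjI allI impI)
  show "Partial_order (subgraph_order V)"
    using partial_order_subgraph_order by (simp add: Field_subgraph_order)
  let ?R = "cover (subgraph_order V) \<union> (cover (subgraph_order V))\<inverse>"
  show "poset_connected (subgraph_order V)"
    unfolding poset_connected_def
  proof (intro ballI)
    fix x y assume xy: "x \<in> Field (subgraph_order V)" "y \<in> Field (subgraph_order V)"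
    have "(empty_pdag, x) \<in> (cover (subgraph_order V))\<^sup>*" "(empty_pdag, y) \<in> (cover (subgraph_order V))\<^sup>*"
      using xy cover_rtrancl_empty[OF assms]
      by (auto simp: Field_subgraph_order polytree_cpdags_iff)
    then have "(empty_pdag, y) \<in> ?R\<^sup>*" "(x, empty_pdag) \<in> ?R\<^sup>*"
      using rtrancl_mono[of "cover (subgraph_order V)" ?R]
        rtrancl_mono[of "(cover (subgraph_order V))\<inverse>" ?R] rtrancl_converseI by fast+
    then have "(x, y) \<in> ?R\<^sup>*" by (meson rtrancl_trans)
    then obtain n where "(x, y) \<in> ?R ^^ n" using rtrancl_imp_relpow by blast
    then show "\<exists>p. poset_path (subgraph_order V) x p y"
      using relpow_poset_path xy(1) by metis
  qed
  fix x y assume cov: "covered_by (subgraph_order V) x y"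
  then obtain D where D: "polytree V D" "y = cpdag_of V D"
    using covered_by_subgraph_orderE assms by blast
  then obtain e where e: "e \<in> D" "x = cpdag_of V (D - {e})"
    using cov covered_by_subgraph_order[OF assms] by blast
  have "dag V D" "dag V (D - {e})" "finite D"
    using D e polytree_dag polytree_subset dag_finite assms by blast+
  then show "num_edges y = num_edges x + 1"
    using num_edges_cpdag_of[OF assms] D e card_Suc_Diff1[of D e] by simp
next
  have "y = empty_pdag" if "(y, empty_pdag) \<in> subgraph_order V" for y :: "'a pdag"
    using that empty_least[of y V] partial_order_subgraph_order[of V]
    unfolding partial_order_on_def antisym_def subgraph_order_def by blast
  then show "\<exists>x\<in>Field (subgraph_order V). (\<forall>y. (y, x) \<in> subgraph_order V \<longrightarrow> y = x) \<and> num_edges x = 0"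
    using empty_polytree_cpdag[of V]
    by (intro bexI[of _ empty_pdag]) (auto simp: Field_subgraph_order num_edges_def empty_pdag_def)
qed

text \<open>A greatest element would have to contain both a collider and a chain on the same three
  vertices.\<close>
lemma no_greatest:
  assumes "card V > 2"
  shows "\<not> (\<exists>M\<in>polytree_cpdags V. \<forall>G\<in>polytree_cpdags V. (G, M) \<in> subgraph_order V)"
proof
  assume "\<exists>M\<in>polytree_cpdags V. \<forall>G\<in>polytree_cpdags V. (G, M) \<in> subgraph_order V"
  then obtain D where D: "polytree V D" "\<forall>G\<in>polytree_cpdags V. (G, cpdag_of V D) \<in> subgraph_order V"
    by (auto simp: polytree_cpdags_iff)
  obtain T where T: "T \<subseteq> V" "card T = 3"
    using obtain_subset_with_card_n[of 3 V] assms by (metis Suc_leI eval_nat_numeral(3))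
  then obtain a b c where abc: "T = {a, b, c}" "a \<noteq> b" "a \<noteq> c" "b \<noteq> c"
    by (auto simp: card_3_iff)
  have tri: "polytree V E" if E: "dag V E" "skeleton E = {{a, b}, {c, b}}" for E
    unfolding polytree_def
  proof (intro conjI notI)
    show "dag V E" by fact
    assume "\<exists>p. ucycle (skeleton E) p"
    then obtain p where p: "ucycle {{a, b}, {c, b}} p" using E by auto
    obtain x y z q where xyz: "p = x # y # z # q"
      using p unfolding ucycle_def by (metis Suc_le_length_iff numeral_3_eq_3)
    \<comment> \<open>Each edge contains \<open>b\<close>, so one of any two cyclically consecutive
      vertices is \<open>b\<close>; three such pairs cannot be met by distinct vertices.\<close>
    have "last p = b \<or> x = b" "y = b \<or> x = b" "y = b \<or> z = b"
      using p abc unfolding xyz ucycle_def upath_iff_successively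
      by (auto simp: doubleton_eq_iff)
    moreover have "last p \<in> set (z # q)" "distinct p"
      using p by (auto simp: xyz ucycle_def upath_iff_successively)
    ultimately have "x = b" by (auto simp: xyz)
    then have "y \<noteq> b" "z \<noteq> b" using \<open>distinct p\<close> by (auto simp: xyz)
    then show False using \<open>y = b \<or> z = b\<close> by simp
  qed
  let ?D1 = "{(a, b), (c, b)}" and ?D2 = "{(a, b), (b, c)}"
  have "acyclic ?D1"
    by (rule acyclicI_order[where f = "\<lambda>x. if x = b then 0 else 1 :: nat"]) (use abc in auto)
  moreover have "acyclic ?D2"
    by (rule acyclicI_order[where f = "\<lambda>x. if x = a then 2 else if x = b then 1 else 0 :: nat"])
      (use abc in auto)
  ultimately have "dag V ?D1" "dag V ?D2" using abc T by (auto simp: dag_def)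
  moreover have "skeleton ?D1 = {{a, b}, {c, b}}" "skeleton ?D2 = {{a, b}, {c, b}}"
    by (auto simp: skeleton_def)
  ultimately have P: "polytree V ?D1" "polytree V ?D2" using tri by blast+
  then have "embeds ?D1 D" "embeds ?D2 D"
    using D subgraph_order_cpdag_of polytree_cpdags_iff by blast+
  then have "collider ?D1 a b c \<longleftrightarrow> collider D a b c" "collider ?D2 a b c \<longleftrightarrow> collider D a b c"
    using abc by (auto simp: embeds_def skeleton_iff)
  then show False using abc by (auto simp: collider_def)
qed

section \<open>Conditional independence and indicator functions\<close>

lemma (in prob_space) integrable_bounded:
  fixes f :: "'a \<Rightarrow> real"
  assumes "f \<in> borel_measurable M" "\<And>x. x \<in> space M \<Longrightarrow> \<bar>f x\<bar> \<le> B"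
  shows "integrable M f"
  using assms by (intro integrable_const_bound[of f B]) auto

lemma sets_vimage_algebra_measurable:
  assumes "Z \<in> measurable P U"
  shows "sets (vimage_algebra (space P) Z U) = {Z -` G \<inter> space P | G. G \<in> sets U}"
  using assms by (intro sets_vimage_algebra2) (auto dest: measurable_space)

lemma sigma_finite_subalgebra_vimage:
  assumes "prob_space P" "Z \<in> measurable P U"
  shows "sigma_finite_subalgebra P (vimage_algebra (space P) Z U)"
proof -
  interpret prob_space P by fact
  have "subalgebra P (vimage_algebra (space P) Z U)"
    using assms(2) by (auto simp: subalgebra_def sets_vimage_algebra_measurable)
  then have "finite_measure_subalgebra P (vimage_algebra (space P) Z U)"
    by unfold_locales
  then show ?thesis by (rule finite_measure_subalgebra_is_sigma_finite)
qed

text \<open>The function \<open>e\<close> is a version of the conditional probability of \<open>X \<in> E\<close> given \<open>Y\<close> and \<open>Z\<close>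
  that depends on \<open>Z\<close> alone.\<close>
lemma cond_indep_varI:
  assumes P: "prob_space P"
    and X: "X \<in> measurable P S" and Y: "Y \<in> measurable P T" and Z: "Z \<in> measurable P U"
    and e: "\<And>E. E \<in> sets S \<Longrightarrow> \<exists>e \<in> borel_measurable (vimage_algebra (space P) Z U).
      (\<forall>x\<in>space P. \<bar>e x\<bar> \<le> 1) \<and>
      (\<forall>F\<in>sets T. \<forall>G\<in>sets U.
        (\<integral>x. indicator (X -` E \<inter> space P) x * (indicator (Y -` F \<inter> space P) x * indicator (Z -` G \<inter> space P) x) \<partial>P)
        = (\<integral>x. (indicator (Y -` F \<inter> space P) x * indicator (Z -` G \<inter> space P) x) * (e x :: real) \<partial>P))"
  shows "cond_indep_var P S X T Y U Z"
  unfolding cond_indep_var_def Let_def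
proof (intro ballI)
  interpret prob_space P by fact
  define C where "C = vimage_algebra (space P) Z U"
  interpret C: sigma_finite_subalgebra P C
    unfolding C_def by (rule sigma_finite_subalgebra_vimage[OF P Z])
  fix E F assume E: "E \<in> sets S" and F: "F \<in> sets T"
  define XE where "XE = X -` E \<inter> space P"
  define YF where "YF = Y -` F \<inter> space P"
  have XE[measurable]: "XE \<in> sets P" and YF[measurable]: "YF \<in> sets P"
    using X Y E F by (auto simp: XE_def YF_def)
  obtain e where eC: "e \<in> borel_measurable C" and e1: "\<And>x. x \<in> space P \<Longrightarrow> \<bar>e x\<bar> \<le> 1"
    and ei: "\<And>F G. F \<in> sets T \<Longrightarrow> G \<in> sets U \<Longrightarrow>
      (\<integral>x. indicator XE x * (indicator (Y -` F \<inter> space P) x * indicator (Z -` G \<inter> space P) x) \<partial>P)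
        = (\<integral>x. (indicator (Y -` F \<inter> space P) x * indicator (Z -` G \<inter> space P) x) * (e x :: real) \<partial>P)"
    using e[OF E] unfolding C_def XE_def by blast
  have eP[measurable]: "e \<in> borel_measurable P"
    by (rule measurable_from_subalg[OF C.subalg eC])
  have int_e: "integrable P e" using e1 by (intro integrable_bounded[of e 1]) auto
  have setsC: "sets C = {Z -` G \<inter> space P | G. G \<in> sets U}"
    unfolding C_def by (rule sets_vimage_algebra_measurable[OF Z])
  have key: "(\<integral>x. indicator XE x * (indicator (Y -` F' \<inter> space P) x * indicator H x) \<partial>P)
        = (\<integral>x. (indicator (Y -` F' \<inter> space P) x * indicator H x) * e x \<partial>P)"
    if "F' \<in> sets T" "H \<in> sets C" for F' H
    using that ei unfolding setsC by auto
  have cE: "AE x in P. real_cond_exp P C (indicator XE) x = e x"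
  proof (rule C.real_cond_exp_charact[OF _ _ int_e eC])
    show "integrable P (indicator XE :: _ \<Rightarrow> real)" by (intro integrable_bounded[of _ 1]) (auto simp: indicator_def)
    fix H assume H: "H \<in> sets C"
    \<comment> \<open>With \<open>F' = space T\<close> the variable \<open>Y\<close> disappears from
      \<open>key\<close>, and \<open>e\<close> becomes a version of the conditional probability
      given \<open>Z\<close> alone.\<close>
    have sp: "Y -` space T \<inter> space P = space P" using Y by (auto dest: measurable_space)
    have "(LINT x:H|P. indicator XE x) = (\<integral>x. indicator XE x * (indicator (Y -` space T \<inter> space P) x * indicator H x) \<partial>P :: real)"
      unfolding set_lebesgue_integral_def sp
      by (intro Bochner_Integration.integral_cong refl) (auto simp: indicator_def)
    also have "\<dots> = (\<integral>x. (indicator (Y -` space T \<inter> space P) x * indicator H x) * e x \<partial>P)"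
      by (rule key) (use H in auto)
    also have "\<dots> = (LINT x:H|P. e x)"
      unfolding set_lebesgue_integral_def sp
      by (intro Bochner_Integration.integral_cong refl) (auto simp: indicator_def)
    finally show "(LINT x:H|P. indicator XE x) = (LINT x:H|P. e x)" .
  qed
  let ?F = "real_cond_exp P C (indicator YF)"
  have int_F: "integrable P (indicator YF :: _ \<Rightarrow> real)"
    by (intro integrable_bounded[of _ 1]) (auto simp: indicator_def)
  have ieF: "integrable P (\<lambda>x. e x * indicator YF x)"
    using e1 by (intro integrable_bounded[of _ 1]) (auto simp: indicator_def)
  have cEF: "AE x in P. real_cond_exp P C (indicator (XE \<inter> YF)) x = e x * ?F x"
  proof (rule C.real_cond_exp_charact)
    show "integrable P (indicator (XE \<inter> YF) :: _ \<Rightarrow> real)"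
      by (intro integrable_bounded[of _ 1]) (auto simp: indicator_def)
    show "integrable P (\<lambda>x. e x * ?F x)"
      by (rule C.real_cond_exp_intg(1)[OF ieF eC]) auto
    show "(\<lambda>x. e x * ?F x) \<in> borel_measurable C" using eC by auto
    fix H assume H: "H \<in> sets C"
    have HP[measurable]: "H \<in> sets P" using H C.subalg by (auto simp: subalgebra_def)
    have eHC: "(\<lambda>x. indicator H x * e x) \<in> borel_measurable C" using H eC by auto
    have ieHF: "integrable P (\<lambda>x. indicator H x * e x * indicator YF x)"
      using e1 by (intro integrable_bounded[of _ 1]) (auto simp: indicator_def)
    have "(LINT x:H|P. indicator (XE \<inter> YF) x) = (\<integral>x. indicator XE x * (indicator YF x * indicator H x) \<partial>P :: real)"
      unfolding set_lebesgue_integral_def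
      by (intro Bochner_Integration.integral_cong refl) (auto simp: indicator_def)
    also have "\<dots> = (\<integral>x. (indicator YF x * indicator H x) * e x \<partial>P)"
      unfolding YF_def by (rule key[OF F H])
    also have "\<dots> = (\<integral>x. indicator H x * e x * indicator YF x \<partial>P)"
      by (intro Bochner_Integration.integral_cong refl) (auto simp: indicator_def)
    \<comment> \<open>The factor in front of the indicator of \<open>YF\<close> is
      \<open>C\<close>-measurable, so the indicator may be replaced by its conditional
      expectation.\<close>
    also have "\<dots> = (\<integral>x. indicator H x * e x * ?F x \<partial>P)"
      by (rule C.real_cond_exp_intg(2)[OF ieHF eHC, symmetric]) auto
    also have "\<dots> = (LINT x:H|P. e x * ?F x)"
      unfolding set_lebesgue_integral_def by (simp add: mult.assoc)
    finally show "(LINT x:H|P. indicator (XE \<inter> YF) x) = (LINT x:H|P. e x * ?F x)" .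
  qed
  show "AE w in P. real_cond_exp P (vimage_algebra (space P) Z U)
          (indicator ((X -` E \<inter> space P) \<inter> (Y -` F \<inter> space P))) w =
        real_cond_exp P (vimage_algebra (space P) Z U) (indicator (X -` E \<inter> space P)) w *
        real_cond_exp P (vimage_algebra (space P) Z U) (indicator (Y -` F \<inter> space P)) w"
    using cE cEF unfolding C_def[symmetric] XE_def[symmetric] YF_def[symmetric]
    by eventually_elim simp
qed

text \<open>The hypotheses \<open>half\<close> say that both conditional probabilities are
  constantly 1/2, so independence makes the joint one 1/4. This turns an almost sure statement into
  an identity of integrals that can be tested.\<close>

lemma cond_indep_var_half:
  assumes P: "prob_space P"
    and X: "X \<in> measurable P S" and Y: "Y \<in> measurable P T" and Z: "Z \<in> measurable P U"
    and ci: "cond_indep_var P S X T Y U Z"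
    and E: "E \<in> sets S" and F: "F \<in> sets T"
    and half: "\<And>H. H \<in> sets (vimage_algebra (space P) Z U) \<Longrightarrow>
        (\<integral>x. indicator H x * indicator (X -` E \<inter> space P) x \<partial>P) = (1/2 :: real) * (\<integral>x. indicator H x \<partial>P)"
      "\<And>H. H \<in> sets (vimage_algebra (space P) Z U) \<Longrightarrow>
        (\<integral>x. indicator H x * indicator (Y -` F \<inter> space P) x \<partial>P) = (1/2 :: real) * (\<integral>x. indicator H x \<partial>P)"
    and H: "H \<in> sets (vimage_algebra (space P) Z U)"
  shows "(\<integral>x. indicator H x * (indicator (X -` E \<inter> space P) x * indicator (Y -` F \<inter> space P) x) \<partial>P)
    = (1/4 :: real) * (\<integral>x. indicator H x \<partial>P)"
proof -
  interpret prob_space P by fact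
  define C where "C = vimage_algebra (space P) Z U"
  interpret C: sigma_finite_subalgebra P C
    unfolding C_def by (rule sigma_finite_subalgebra_vimage[OF P Z])
  define XE where "XE = X -` E \<inter> space P"
  define YF where "YF = Y -` F \<inter> space P"
  have XE[measurable]: "XE \<in> sets P" and YF[measurable]: "YF \<in> sets P"
    using X Y E F by (auto simp: XE_def YF_def)
  have halfC: "AE x in P. real_cond_exp P C (indicator A) x = 1/2"
    if A[measurable]: "A \<in> sets P"
      and "\<And>H. H \<in> sets C \<Longrightarrow> (\<integral>x. indicator H x * indicator A x \<partial>P) = (1/2 :: real) * (\<integral>x. indicator H x \<partial>P)"
    for A
  proof (rule C.real_cond_exp_charact)
    show "integrable P (indicator A :: _ \<Rightarrow> real)"
      by (intro integrable_bounded[of _ 1]) (auto simp: indicator_def)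
    fix H assume "H \<in> sets C"
    then show "(LINT x:H|P. indicator A x) = (LINT x:H|P. 1/2 :: real)"
      using that(2)[of H] by (simp add: set_lebesgue_integral_def)
  qed auto
  have HC: "H \<in> sets C" using H by (simp add: C_def)
  then have [measurable]: "H \<in> sets P" using C.subalg by (auto simp: subalgebra_def)
  have "AE x in P. real_cond_exp P C (indicator (XE \<inter> YF)) x
      = real_cond_exp P C (indicator XE) x * real_cond_exp P C (indicator YF) x"
    using ci E F unfolding cond_indep_var_def Let_def C_def XE_def YF_def by blast
  moreover have "AE x in P. real_cond_exp P C (indicator XE) x = 1/2"
    by (rule halfC) (use half(1) in \<open>auto simp: C_def XE_def[symmetric]\<close>)
  moreover have "AE x in P. real_cond_exp P C (indicator YF) x = 1/2"
    by (rule halfC) (use half(2) in \<open>auto simp: C_def YF_def[symmetric]\<close>)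
  ultimately have ae: "AE x in P. real_cond_exp P C (indicator (XE \<inter> YF)) x = 1/4"
    by eventually_elim simp
  have "(\<integral>x. indicator H x * (indicator XE x * indicator YF x) \<partial>P) = (LINT x:H|P. indicator (XE \<inter> YF) x :: real)"
    unfolding set_lebesgue_integral_def
    by (intro Bochner_Integration.integral_cong refl) (auto simp: indicator_def)
  also have "\<dots> = (LINT x:H|P. real_cond_exp P C (indicator (XE \<inter> YF)) x)"
    by (rule C.real_cond_exp_intA[OF _ HC]) (intro integrable_bounded[of _ 1], auto simp: indicator_def)
  also have "\<dots> = (LINT x:H|P. 1/4)"
    unfolding set_lebesgue_integral_def
    by (intro integral_cong_AE) (use ae in auto)
  also have "\<dots> = 1/4 * (\<integral>x. indicator H x \<partial>P)"
    by (simp add: set_lebesgue_integral_def)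
  finally show ?thesis by (simp add: XE_def YF_def)
qed

section \<open>Product spaces with a fair event in each coordinate\<close>

text \<open>All functions are compared, not only points of the product space, so \<open>u\<close>
  can be evaluated at merges and restrictions, which may be \<open>undefined\<close> on some
  coordinates.\<close>

definition depends_only :: "'v set \<Rightarrow> (('v \<Rightarrow> 'a) \<Rightarrow> 'b) \<Rightarrow> bool" where
  "depends_only S u \<longleftrightarrow> (\<forall>x y. (\<forall>v\<in>S. x v = y v) \<longrightarrow> u x = u y)"

lemma depends_onlyD: "depends_only S u \<Longrightarrow> (\<And>v. v \<in> S \<Longrightarrow> x v = y v) \<Longrightarrow> u x = u y"
  by (auto simp: depends_only_def)

lemma depends_only_restrict: "depends_only S (\<lambda>x. k (restrict x S))"
  unfolding depends_only_def by (metis restrict_ext)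

locale fair_events = finite_product_prob_space N V
  for N :: "'v \<Rightarrow> 'a measure" and V :: "'v set" +
  fixes W :: "'v \<Rightarrow> 'a set"
  assumes W_sets: "\<And>v. v \<in> V \<Longrightarrow> W v \<in> sets (N v)"
    and W_half: "\<And>v. v \<in> V \<Longrightarrow> measure (N v) (W v) = 1/2"
begin

abbreviation Q :: "('v \<Rightarrow> 'a) measure" where
  "Q \<equiv> PiM V N"

text \<open>Boundedness gives closure under products while keeping every member integrable.\<close>

definition local_fun :: "'v set \<Rightarrow> (('v \<Rightarrow> 'a) \<Rightarrow> real) \<Rightarrow> bool" where
  "local_fun S u \<longleftrightarrow>
     u \<in> borel_measurable Q \<and> (\<exists>B. \<forall>x\<in>space Q. \<bar>u x\<bar> \<le> B) \<and> depends_only S u"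

lemma local_fun_measurable: "local_fun S u \<Longrightarrow> u \<in> borel_measurable Q"
  by (simp add: local_fun_def)

lemma local_fun_integrable: "local_fun S u \<Longrightarrow> integrable Q u"
  unfolding local_fun_def using integrable_bounded by blast

lemma local_fun_mono: "local_fun S u \<Longrightarrow> S \<subseteq> T \<Longrightarrow> local_fun T u"
  unfolding local_fun_def depends_only_def by blast

lemma local_fun_const: "local_fun S (\<lambda>x. c)"
  by (auto simp: local_fun_def depends_only_def)

lemma local_fun_mult:
  assumes "local_fun S u" "local_fun S w"
  shows "local_fun S (\<lambda>x. u x * w x)"
proof -
  obtain B1 B2 where B: "\<And>x. x \<in> space Q \<Longrightarrow> \<bar>u x\<bar> \<le> B1" "\<And>x. x \<in> space Q \<Longrightarrow> \<bar>w x\<bar> \<le> B2"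
    using assms by (auto simp: local_fun_def)
  then have "\<bar>u x * w x\<bar> \<le> B1 * B2" if "x \<in> space Q" for x
    using mult_mono[of "\<bar>u x\<bar>" B1 "\<bar>w x\<bar>" B2] that by (fastforce simp: abs_mult)
  moreover have "depends_only S (\<lambda>x. u x * w x)"
    using assms unfolding local_fun_def depends_only_def by metis
  ultimately show ?thesis using assms by (auto simp: local_fun_def)
qed

lemma local_fun_add:
  assumes "local_fun S u" "local_fun S w"
  shows "local_fun S (\<lambda>x. u x + w x)"
proof -
  obtain B1 B2 where B: "\<And>x. x \<in> space Q \<Longrightarrow> \<bar>u x\<bar> \<le> B1" "\<And>x. x \<in> space Q \<Longrightarrow> \<bar>w x\<bar> \<le> B2"
    using assms by (auto simp: local_fun_def)
  then have "\<bar>u x + w x\<bar> \<le> B1 + B2" if "x \<in> space Q" for x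
    using that abs_triangle_ineq[of "u x" "w x"] B(1)[OF that] B(2)[OF that] by linarith
  moreover have "depends_only S (\<lambda>x. u x + w x)"
    using assms unfolding local_fun_def depends_only_def by metis
  ultimately show ?thesis using assms by (auto simp: local_fun_def)
qed

lemma local_fun_prod:
  assumes "\<And>i. i \<in> I \<Longrightarrow> local_fun S (u i)"
  shows "local_fun S (\<lambda>x. \<Prod>i\<in>I. u i x)"
  using assms by (induction I rule: infinite_finite_induct) (auto intro: local_fun_const local_fun_mult)

lemma local_fun_indicator:
  assumes "S \<subseteq> V" "E \<in> sets (PiM S N)"
  shows "local_fun S (\<lambda>x. indicator E (restrict x S))"
proof -
  have "(\<lambda>x. restrict x S) \<in> measurable Q (PiM S N)"
    using assms(1) by (rule measurable_restrict_subset)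
  then have "(\<lambda>x. indicator E (restrict x S) :: real) \<in> borel_measurable Q"
    by (rule measurable_compose) (rule borel_measurable_indicator[OF assms(2)])
  then show ?thesis
    unfolding local_fun_def using depends_only_restrict[of S "indicator E :: _ \<Rightarrow> real"]
    by (auto intro!: exI[of _ 1] simp: indicator_def)
qed

text \<open>Under the product measure this is the conditional expectation of \<open>u\<close> given
  the coordinates in \<open>V - S\<close>.\<close>

definition average :: "'v set \<Rightarrow> (('v \<Rightarrow> 'a) \<Rightarrow> real) \<Rightarrow> ('v \<Rightarrow> 'a) \<Rightarrow> real" where
  "average S u x = (\<integral>y. u (merge S (V - S) (y, x)) \<partial>PiM S N)"

text \<open>Fubini for the splitting into \<open>S\<close> and \<open>V - S\<close>. The outer
  integral can be taken over all of \<open>Q\<close>, as the average does not read the coordinates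
  in \<open>S\<close>.\<close>

lemma integral_average:
  assumes S: "S \<subseteq> V" and u: "local_fun V u"
  shows "(\<integral>x. u x \<partial>Q) = (\<integral>x. average S u x \<partial>Q)"
proof -
  interpret S: prob_space "PiM S N" using prob_space by (rule prob_space_PiM)
  have fin: "finite S" "finite (V - S)" using S finite_index finite_subset by auto
  have un: "(V - S) \<union> S = V" "S \<union> (V - S) = V" using S by auto
  have swap: "merge (V - S) S (x, y) = merge S (V - S) (y, x)" for x y :: "'v \<Rightarrow> 'a"
    by (auto simp: merge_def fun_eq_iff)
  have "(\<integral>x. u x \<partial>Q) = (\<integral>x. average S u x \<partial>PiM (V - S) N)"
    using product_integral_fold[OF _ fin(2,1), of u] local_fun_integrable[OF u]
    unfolding average_def by (simp only: un swap) auto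
  also have "PiM (V - S) N = distr Q (PiM (V - S) N) (\<lambda>x. restrict x (V - S))"
    by (rule distr_restrict) (use finite_index in auto)
  also have "(\<integral>x. average S u x \<partial>distr Q (PiM (V - S) N) (\<lambda>x. restrict x (V - S)))
      = (\<integral>x. average S u (restrict x (V - S)) \<partial>Q)"
  proof (rule integral_distr)
    show "(\<lambda>x. restrict x (V - S)) \<in> measurable Q (PiM (V - S) N)"
      by (rule measurable_restrict_subset) auto
    have "(\<lambda>(x, y). merge S (V - S) (y, x)) \<in> measurable (PiM (V - S) N \<Otimes>\<^sub>M PiM S N) Q"
      using measurable_compose[OF measurable_pair_swap' measurable_merge[of S "V - S" N]]
      by (simp add: Un_absorb1[OF S] split_beta)
    then have "(\<lambda>(x, y). u (merge S (V - S) (y, x))) \<in> borel_measurable (PiM (V - S) N \<Otimes>\<^sub>M PiM S N)"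
      by (auto dest: measurable_compose[OF _ local_fun_measurable[OF u]] simp: split_beta)
    then show "average S u \<in> borel_measurable (PiM (V - S) N)"
      unfolding average_def by (rule S.borel_measurable_lebesgue_integral)
  qed
  also have "\<dots> = (\<integral>x. average S u x \<partial>Q)"
    unfolding average_def
    by (intro Bochner_Integration.integral_cong refl arg_cong[of _ _ u])
      (auto simp: merge_def fun_eq_iff)
  finally show ?thesis .
qed

lemma average_mult:
  assumes "depends_only (V - S) w"
  shows "average S (\<lambda>x. u x * w x) x = average S u x * w x"
proof -
  have "w (merge S (V - S) (y, x)) = w x" for y
    by (rule depends_onlyD[OF assms]) (auto simp: merge_def)
  then show ?thesis by (simp add: average_def)
qed

lemma integral_mult_local:
  assumes "S \<subseteq> V" "local_fun V u" "local_fun (V - S) w"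
  shows "(\<integral>x. u x * w x \<partial>Q) = (\<integral>x. average S u x * w x \<partial>Q)"
proof -
  have "local_fun V w" using assms(3) local_fun_mono by blast
  then have "(\<integral>x. u x * w x \<partial>Q) = (\<integral>x. average S (\<lambda>x. u x * w x) x \<partial>Q)"
    using assms by (intro integral_average local_fun_mult)
  then show ?thesis using average_mult assms(3) by (simp add: local_fun_def)
qed

definition sign :: "'v \<Rightarrow> ('v \<Rightarrow> 'a) \<Rightarrow> real" where
  "sign v x = (if x v \<in> W v then 1 else -1)"

lemma sign_square: "sign v x * sign v x = 1"
  by (simp add: sign_def)

lemma abs_sign: "\<bar>sign v x\<bar> = 1"
  by (simp add: sign_def)

lemma sign_measurable:
  assumes "v \<in> S" "v \<in> V"
  shows "sign v \<in> borel_measurable (PiM S N)"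
proof -
  have [measurable]: "W v \<in> sets (N v)" "(\<lambda>x. x v) \<in> measurable (PiM S N) (N v)"
    using W_sets assms by auto
  show ?thesis unfolding sign_def by measurable
qed

lemma local_fun_sign: "v \<in> S \<Longrightarrow> v \<in> V \<Longrightarrow> local_fun S (sign v)"
  using sign_measurable[of v V] abs_sign unfolding local_fun_def depends_only_def
  by (auto simp: sign_def)

text \<open>Here the probability 1/2 enters: averaging the sign over its own coordinate gives 2 *
  (1/2) - 1 = 0, and \<open>w\<close> is unaffected by this averaging.\<close>

lemma integral_sign_mult:
  assumes v: "v \<in> V" and w: "local_fun (V - {v}) w"
  shows "(\<integral>x. sign v x * w x \<partial>Q) = 0"
proof -
  have [measurable]: "W v \<in> sets (N v)" using W_sets v by auto
  have "average {v} (sign v) x = 0" for x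
  proof -
    have "average {v} (sign v) x = (\<integral>y. (\<lambda>t. 2 * indicator (W v) t - 1 :: real) (y v) \<partial>PiM {v} N)"
      unfolding average_def
      by (intro Bochner_Integration.integral_cong refl) (auto simp: sign_def merge_def)
    also have "\<dots> = (\<integral>t. 2 * indicator (W v) t - 1 \<partial>N v)"
      by (rule product_integral_singleton) measurable
    also have "\<dots> = 2 * measure (N v) (W v) - 1"
    proof -
      have "integrable (N v) (indicator (W v) :: 'a \<Rightarrow> real)"
        by (rule prob_space.integrable_bounded[OF prob_space, of _ _ 1]) (auto simp: indicator_def)
      then show ?thesis
        using prob_space.prob_space[OF prob_space[of v]] by simp
    qed
    finally show ?thesis using W_half v by simp
  qed
  then show ?thesis
    using integral_mult_local[of "{v}" "sign v" w] v w local_fun_sign[of v V] by simp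
qed

end

section \<open>Conditional independence by factorisation\<close>

context fair_events
begin

lemma prob_space_density:
  assumes "local_fun V f" "\<And>x. 0 \<le> f x" "(\<integral>x. f x \<partial>Q) = 1"
  shows "prob_space (density Q f)"
proof (rule prob_spaceI)
  have "emeasure (density Q f) (space (density Q f)) = (\<integral>\<^sup>+x. f x \<partial>Q)"
    by (subst emeasure_density)
      (use local_fun_measurable[OF assms(1)] in \<open>auto intro!: nn_integral_cong\<close>)
  also have "\<dots> = ennreal (\<integral>x. f x \<partial>Q)"
    using local_fun_integrable[OF assms(1)] assms(2) by (intro nn_integral_eq_integral) auto
  finally show "emeasure (density Q f) (space (density Q f)) = 1" using assms(3) by simp
qed

lemma integral_density_local:
  fixes u :: "('v \<Rightarrow> 'a) \<Rightarrow> real"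
  assumes "u \<in> borel_measurable Q" "local_fun V f" "\<And>x. 0 \<le> f x"
  shows "(\<integral>x. u x \<partial>density Q f) = (\<integral>x. f x * u x \<partial>Q)"
  using integral_density[OF assms(1) local_fun_measurable[OF assms(2)]] assms(3) by simp

lemma average_marginal:
  assumes disj: "A' \<subseteq> V" "C \<subseteq> V" "A' \<inter> C = {}" and A: "A \<subseteq> A'"
    and g: "depends_only (A' \<union> C) g"
  shows "average A' (\<lambda>x. k (restrict x A) * g x) x
    = (\<integral>y. k (restrict y A) * g (merge A' C (y, restrict x C)) \<partial>PiM A' N)"
  unfolding average_def
proof (intro Bochner_Integration.integral_cong refl)
  fix y
  have "restrict (merge A' (V - A') (y, x)) A = restrict y A"
    using A by (auto simp: merge_def fun_eq_iff)
  moreover have "g (merge A' (V - A') (y, x)) = g (merge A' C (y, restrict x C))"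
    by (rule depends_onlyD[OF g]) (use disj in \<open>auto simp: merge_def\<close>)
  ultimately show "k (restrict (merge A' (V - A') (y, x)) A) * g (merge A' (V - A') (y, x))
      = k (restrict y A) * g (merge A' C (y, restrict x C))" by simp
qed

text \<open>The conditional probability of an event \<open>E\<close> of the coordinates in \<open>A\<close> is \<open>kE / k1\<close>, the ratio
  of the averages over \<open>A'\<close> of \<open>g\<close> with and without the indicator of \<open>E\<close>. Division by zero is
  harmless, since \<open>kE\<close> vanishes wherever \<open>k1\<close> does.\<close>
lemma cond_indep_factorisation:
  assumes sub: "A \<subseteq> V" "B \<subseteq> V" "C \<subseteq> V"
    and A': "A \<subseteq> A'" "A' \<subseteq> V" "A' \<inter> (B \<union> C) = {}"
    and f: "local_fun V f" "\<And>x. 0 \<le> f x" "(\<integral>x. f x \<partial>Q) = 1"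
    and g: "g \<in> borel_measurable (PiM (A' \<union> C) N)" "\<And>x. 0 \<le> g x" "\<And>x. g x \<le> K"
      "depends_only (A' \<union> C) g"
    and h: "local_fun (V - A') h"
    and fgh: "\<And>w. local_fun (A \<union> B \<union> C) w \<Longrightarrow> (\<integral>x. f x * w x \<partial>Q) = (\<integral>x. g x * h x * w x \<partial>Q)"
  shows "cond_indep_var (density Q f) (PiM A N) (\<lambda>x. restrict x A) (PiM B N) (\<lambda>x. restrict x B)
    (PiM C N) (\<lambda>x. restrict x C)"
proof (rule cond_indep_varI)
  let ?P = "density Q f"
  have int_P: "(\<integral>x. u x \<partial>?P) = (\<integral>x. f x * u x \<partial>Q)" if "u \<in> borel_measurable Q" for u :: "_ \<Rightarrow> real"
    using that f(1,2) by (rule integral_density_local)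
  show "prob_space ?P" using f by (rule prob_space_density)
  have rm: "(\<lambda>x. restrict x S) \<in> measurable Q (PiM S N)" if "S \<subseteq> V" for S
    using that by (rule measurable_restrict_subset)
  then show "(\<lambda>x. restrict x A) \<in> measurable ?P (PiM A N)"
    "(\<lambda>x. restrict x B) \<in> measurable ?P (PiM B N)"
    "(\<lambda>x. restrict x C) \<in> measurable ?P (PiM C N)"
    using sub by auto
  fix E assume E: "E \<in> sets (PiM A N)"
  interpret S: prob_space "PiM A' N" using prob_space by (rule prob_space_PiM)
  have AC: "A' \<union> C \<subseteq> V" "A' \<inter> C = {}" "C \<subseteq> V - A'" "A \<union> B \<union> C \<subseteq> V" using sub A' by auto
  define kE where "kE z = (\<integral>y. indicator E (restrict y A) * g (merge A' C (y, z)) \<partial>PiM A' N)" for z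
  define k1 where "k1 z = (\<integral>y. g (merge A' C (y, z)) \<partial>PiM A' N)" for z
  have gm: "(\<lambda>(z, y). g (merge A' C (y, z))) \<in> borel_measurable (PiM C N \<Otimes>\<^sub>M PiM A' N)"
    using measurable_compose[OF measurable_compose[OF measurable_pair_swap' measurable_merge[of A' C N]] g(1)]
    by (simp add: split_beta)
  have EA: "(\<lambda>y. indicator E (restrict y A) :: real) \<in> borel_measurable (PiM A' N)"
    using measurable_compose[OF measurable_restrict_subset[OF A'(1)] borel_measurable_indicator[OF E]] .
  have gEm: "(\<lambda>(z, y). indicator E (restrict y A) * g (merge A' C (y, z))) \<in> borel_measurable (PiM C N \<Otimes>\<^sub>M PiM A' N)"
    using borel_measurable_times[OF measurable_compose[OF measurable_snd EA] gm] by (simp add: split_beta)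
  have k_meas: "kE \<in> borel_measurable (PiM C N)" "k1 \<in> borel_measurable (PiM C N)"
    unfolding kE_def k1_def
    using S.borel_measurable_lebesgue_integral[OF gEm] S.borel_measurable_lebesgue_integral[OF gm] by auto
  have gz: "(\<lambda>y. g (merge A' C (y, z))) \<in> borel_measurable (PiM A' N)" if "z \<in> space (PiM C N)" for z
    using measurable_Pair2[OF gm that] by simp
  have k_bounds: "0 \<le> kE z" "kE z \<le> k1 z" if z: "z \<in> space (PiM C N)" for z
  proof -
    show "0 \<le> kE z" unfolding kE_def using g(2) by (intro integral_nonneg_AE) (auto simp: indicator_def)
    have "integrable (PiM A' N) (\<lambda>y. indicator E (restrict y A) * g (merge A' C (y, z)))"
      by (rule S.integrable_bounded[of _ K])
        (use g(2,3) EA gz[OF z] order_trans[OF g(2) g(3)] in \<open>auto simp: indicator_def\<close>)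
    moreover have "integrable (PiM A' N) (\<lambda>y. g (merge A' C (y, z)))"
      by (rule S.integrable_bounded[of _ K]) (use g(2,3) gz[OF z] in auto)
    ultimately show "kE z \<le> k1 z"
      unfolding kE_def k1_def by (rule integral_mono) (use g(2) in \<open>auto simp: indicator_def\<close>)
  qed
  define e where "e x = kE (restrict x C) / k1 (restrict x C)" for x :: "'v \<Rightarrow> 'a"
  have rC: "restrict x C \<in> space (PiM C N)" if "x \<in> space Q" for x
    using measurable_space[OF rm[OF sub(3)] that] .
  have e1: "\<bar>e x\<bar> \<le> 1" if "x \<in> space Q" for x
    using k_bounds[OF rC[OF that]] by (auto simp: e_def divide_le_eq_1)
  have ke: "kE (restrict x C) = k1 (restrict x C) * e x" if "x \<in> space Q" for x
    using k_bounds[OF rC[OF that]] by (auto simp: e_def)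
  have em: "(\<lambda>z. kE z / k1 z) \<in> borel_measurable (PiM C N)" using k_meas by auto
  have loc_e: "local_fun C e"
    unfolding local_fun_def e_def
    using measurable_compose[OF rm[OF sub(3)] em] e1 depends_only_restrict[of C "\<lambda>z. kE z / k1 z"]
    unfolding e_def by blast
  have eC: "e \<in> borel_measurable (vimage_algebra (space ?P) (\<lambda>x. restrict x C) (PiM C N))"
  proof -
    have "(\<lambda>x. restrict x C) \<in> measurable (vimage_algebra (space ?P) (\<lambda>x. restrict x C) (PiM C N)) (PiM C N)"
      by (rule measurable_vimage_algebra1) (use rC in auto)
    then show ?thesis unfolding e_def using measurable_compose[OF _ em] by blast
  qed
  have loc_g: "local_fun (A' \<union> C) g"
  proof -
    have "g = (\<lambda>x. g (restrict x (A' \<union> C)))"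
      by (intro ext depends_onlyD[OF g(4)]) auto
    then have "g \<in> borel_measurable Q"
      using measurable_compose[OF rm[OF AC(1)] g(1)] by metis
    then show ?thesis using g unfolding local_fun_def by (auto intro!: exI[of _ K])
  qed
  have loc_E: "local_fun A (\<lambda>x. indicator E (restrict x A))"
    using local_fun_indicator[OF sub(1) E] .
  show "\<exists>e \<in> borel_measurable (vimage_algebra (space ?P) (\<lambda>x. restrict x C) (PiM C N)).
      (\<forall>x\<in>space ?P. \<bar>e x\<bar> \<le> 1) \<and>
      (\<forall>F\<in>sets (PiM B N). \<forall>G\<in>sets (PiM C N).
        (\<integral>x. indicator ((\<lambda>x. restrict x A) -` E \<inter> space ?P) x * (indicator ((\<lambda>x. restrict x B) -` F \<inter> space ?P) x * indicator ((\<lambda>x. restrict x C) -` G \<inter> space ?P) x) \<partial>?P)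
        = (\<integral>x. (indicator ((\<lambda>x. restrict x B) -` F \<inter> space ?P) x * indicator ((\<lambda>x. restrict x C) -` G \<inter> space ?P) x) * (e x :: real) \<partial>?P))"
  proof (intro bexI[OF _ eC] conjI ballI)
    show "\<bar>e x\<bar> \<le> 1" if "x \<in> space ?P" for x using e1 that by simp
    fix F G assume F: "F \<in> sets (PiM B N)" and G: "G \<in> sets (PiM C N)"
    define w where "w x = (indicator F (restrict x B) * indicator G (restrict x C) :: real)" for x :: "'v \<Rightarrow> 'a"
    define iE where "iE x = (indicator E (restrict x A) :: real)" for x :: "'v \<Rightarrow> 'a"
    have loc_iE: "local_fun A iE" unfolding iE_def by (rule loc_E)
    have loc_w: "local_fun (B \<union> C) w"
      unfolding w_def
      using local_fun_indicator[OF sub(2) F] local_fun_indicator[OF sub(3) G]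
      by (intro local_fun_mult) (auto elim: local_fun_mono)
    have up: "local_fun V u" if "local_fun S u" "S \<subseteq> V" for S u using local_fun_mono that by blast
    have up': "local_fun (A \<union> B \<union> C) u" if "local_fun S u" "S \<subseteq> A \<union> B \<union> C" for S u
      using local_fun_mono that by blast
    \<comment> \<open>\<open>A'\<close> consists of all coordinates to be averaged out together with
      \<open>A\<close>. Neither \<open>h\<close> nor \<open>w\<close> reads them, so both pass
      through the average, while the averages \<open>m1\<close> and \<open>m2\<close> of the
      remaining factors read only \<open>C\<close>.\<close>
    have R: "local_fun (V - A') (\<lambda>x. h x * w x)"
      using h loc_w A' sub by (intro local_fun_mult) (auto elim!: local_fun_mono)
    have Re: "local_fun (V - A') (\<lambda>x. e x * (h x * w x))"
      by (rule local_fun_mult[OF local_fun_mono[OF loc_e AC(3)] R])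
    have m1: "average A' (\<lambda>x. iE x * g x) x = kE (restrict x C)" for x
      unfolding iE_def kE_def using average_marginal[OF A'(2) sub(3) AC(2) A'(1) g(4)] .
    have m2: "average A' g x = k1 (restrict x C)" for x
      using average_marginal[OF A'(2) sub(3) AC(2) A'(1) g(4), of "\<lambda>_. 1" x] by (simp add: k1_def)
    have "(\<integral>x. indicator ((\<lambda>x. restrict x A) -` E \<inter> space ?P) x * (indicator ((\<lambda>x. restrict x B) -` F \<inter> space ?P) x * indicator ((\<lambda>x. restrict x C) -` G \<inter> space ?P) x) \<partial>?P)
      = (\<integral>x. iE x * w x \<partial>?P)"
      by (intro Bochner_Integration.integral_cong refl) (auto simp: w_def iE_def indicator_def)
    also have "\<dots> = (\<integral>x. f x * (iE x * w x) \<partial>Q)"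
      using loc_iE loc_w by (intro int_P) (auto simp: local_fun_def)
    \<comment> \<open>The test function reads only \<open>A\<close>, \<open>B\<close> and
      \<open>C\<close>, where \<open>f\<close> may be replaced by \<open>g * h\<close>: other
      coordinates can have been integrated out.\<close>
    also have "\<dots> = (\<integral>x. g x * h x * (iE x * w x) \<partial>Q)"
      using loc_iE loc_w by (intro fgh local_fun_mult) (auto elim!: up')
    also have "\<dots> = (\<integral>x. (iE x * g x) * (h x * w x) \<partial>Q)"
      by (simp add: mult_ac)
    also have "\<dots> = (\<integral>x. average A' (\<lambda>x. iE x * g x) x * (h x * w x) \<partial>Q)"
      by (rule integral_mult_local[OF A'(2) local_fun_mult[OF up[OF loc_iE sub(1)] up[OF loc_g AC(1)]] R])
    \<comment> \<open>By \<open>ke\<close>, the average with the event is \<open>e\<close> times the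
      one without it. The remaining steps undo the averaging and return to \<open>f\<close>.\<close>
    also have "\<dots> = (\<integral>x. average A' g x * (e x * (h x * w x)) \<partial>Q)"
      unfolding m1 m2 by (intro Bochner_Integration.integral_cong refl) (simp add: ke)
    also have "\<dots> = (\<integral>x. g x * (e x * (h x * w x)) \<partial>Q)"
      by (rule integral_mult_local[OF A'(2) up[OF loc_g AC(1)] Re, symmetric])
    also have "\<dots> = (\<integral>x. g x * h x * (w x * e x) \<partial>Q)"
      by (simp add: mult_ac)
    also have "\<dots> = (\<integral>x. f x * (w x * e x) \<partial>Q)"
      using loc_e loc_w by (intro fgh[symmetric] local_fun_mult) (auto elim!: up')
    also have "\<dots> = (\<integral>x. w x * e x \<partial>?P)"
      using loc_e loc_w by (intro int_P[symmetric]) (auto simp: local_fun_def)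
    also have "\<dots> = (\<integral>x. (indicator ((\<lambda>x. restrict x B) -` F \<inter> space ?P) x * indicator ((\<lambda>x. restrict x C) -` G \<inter> space ?P) x) * e x \<partial>?P)"
      by (intro Bochner_Integration.integral_cong refl) (auto simp: w_def indicator_def)
    finally show "(\<integral>x. indicator ((\<lambda>x. restrict x A) -` E \<inter> space ?P) x * (indicator ((\<lambda>x. restrict x B) -` F \<inter> space ?P) x * indicator ((\<lambda>x. restrict x C) -` G \<inter> space ?P) x) \<partial>?P)
        = (\<integral>x. (indicator ((\<lambda>x. restrict x B) -` F \<inter> space ?P) x * indicator ((\<lambda>x. restrict x C) -` G \<inter> space ?P) x) * e x \<partial>?P)" .
  qed
qed

end

section \<open>Laws with prescribed sign correlations\<close>

context fair_events
begin

definition parity :: "'v set \<Rightarrow> ('v \<Rightarrow> 'a) \<Rightarrow> real" where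
  "parity T x = (\<Prod>v\<in>T. sign v x)"

text \<open>For nonempty \<open>T\<close>, the density with respect to \<open>Q\<close> that biases
  only the product of all signs in \<open>T\<close>: the signs in a proper subset stay independent
  and fair. The coefficient 1/2 keeps the density positive.\<close>

definition parity_law :: "'v set \<Rightarrow> ('v \<Rightarrow> 'a) \<Rightarrow> real" where
  "parity_law T x = 1 + parity T x / 2"

lemma abs_parity: "\<bar>parity T x\<bar> = 1"
  by (simp add: parity_def abs_prod abs_sign)

lemma parity_law_bounds: "0 \<le> parity_law T x" "parity_law T x \<le> 3/2"
  using abs_parity[of T x] by (auto simp: parity_law_def abs_le_iff)

lemma parity_measurable: "T \<subseteq> S \<Longrightarrow> T \<subseteq> V \<Longrightarrow> parity T \<in> borel_measurable (PiM S N)"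
  unfolding parity_def by (intro borel_measurable_prod sign_measurable) auto

lemma local_fun_parity: "T \<subseteq> S \<Longrightarrow> T \<subseteq> V \<Longrightarrow> local_fun S (parity T)"
  unfolding parity_def by (intro local_fun_prod local_fun_sign) auto

lemma parity_law_measurable: "T \<subseteq> S \<Longrightarrow> T \<subseteq> V \<Longrightarrow> parity_law T \<in> borel_measurable (PiM S N)"
  using parity_measurable[of T S] unfolding parity_law_def by auto

lemma local_fun_parity_law:
  assumes "T \<subseteq> S" "T \<subseteq> V"
  shows "local_fun S (parity_law T)"
proof -
  have "local_fun S (\<lambda>x. 1 + (1/2) * parity T x)"
    using assms by (intro local_fun_add local_fun_mult local_fun_const local_fun_parity)
  then show ?thesis by (simp add: parity_law_def[abs_def])
qed

lemma depends_only_parity_law: "T \<subseteq> S \<Longrightarrow> depends_only S (parity_law T)"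
  unfolding depends_only_def parity_law_def parity_def sign_def by (metis (no_types, lifting) prod.cong subsetD)

lemma parity_insert: "finite T \<Longrightarrow> z \<notin> T \<Longrightarrow> parity (insert z T) x = sign z x * parity T x"
  by (simp add: parity_def)

lemma integral_parity_mult:
  assumes "z \<in> T" "T \<subseteq> V" "local_fun (V - {z}) w"
  shows "(\<integral>x. parity T x * w x \<partial>Q) = 0"
proof -
  have "finite (T - {z})" using assms(2) finite_index finite_subset by blast
  then have "parity T x = sign z x * parity (T - {z}) x" for x
    using parity_insert[of "T - {z}" z x] assms(1) by (simp add: insert_absorb)
  moreover have "(\<integral>x. sign z x * (parity (T - {z}) x * w x) \<partial>Q) = 0"
    using assms by (intro integral_sign_mult local_fun_mult local_fun_parity) auto
  ultimately show ?thesis by (simp add: mult.assoc)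
qed

lemma integral_parity: "T \<subseteq> V \<Longrightarrow> T \<noteq> {} \<Longrightarrow> (\<integral>x. parity T x \<partial>Q) = 0"
  using integral_parity_mult[OF _ _ local_fun_const, of _ T 1] by auto

lemma integral_parity_law:
  assumes "T \<subseteq> V" "T \<noteq> {}"
  shows "(\<integral>x. parity_law T x \<partial>Q) = 1"
  using integral_parity[OF assms] local_fun_integrable[OF local_fun_parity[OF subset_refl assms(1)]]
  by (simp add: parity_law_def P.prob_space)

text \<open>If some vertex of \<open>T\<close> lies outside \<open>A\<close>, \<open>B\<close> and
  \<open>C\<close>, integrating it out leaves the constant density 1. Otherwise \<open>T\<close>
  misses \<open>A\<close> or \<open>B\<close>, and the whole density is the factor \<open>h\<close>
  or the factor \<open>g\<close> respectively.\<close>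

lemma parity_law_cond_indep:
  assumes T: "T \<subseteq> V" "T \<noteq> {}"
    and tri: "disjoint_triple V A B C"
    and sep: "T \<subseteq> A \<union> B \<union> C \<Longrightarrow> T \<inter> A = {} \<or> T \<inter> B = {}"
  shows "cond_indep_var (density Q (parity_law T)) (PiM A N) (\<lambda>x. restrict x A)
    (PiM B N) (\<lambda>x. restrict x B) (PiM C N) (\<lambda>x. restrict x C)"
proof -
  have sub: "A \<subseteq> V" "B \<subseteq> V" "C \<subseteq> V" "A \<inter> (B \<union> C) = {}"
    using tri by (auto simp: disjoint_triple_def)
  note rule = cond_indep_factorisation[OF sub(1,2,3) subset_refl sub(1,4)
      local_fun_parity_law[OF T(1,1)] parity_law_bounds(1) integral_parity_law[OF T]]
  consider "\<not> T \<subseteq> A \<union> B \<union> C" | "T \<inter> A = {}" | "T \<subseteq> A \<union> C" using sep by blast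
  then show ?thesis
  proof cases
    case 1
    then obtain z where z: "z \<in> T" "z \<notin> A \<union> B \<union> C" by blast
    show ?thesis
    proof (rule rule[where g = "\<lambda>_. 1" and K = 1 and h = "\<lambda>_. 1"])
      fix w assume w: "local_fun (A \<union> B \<union> C) w"
      have "(\<integral>x. parity T x * w x \<partial>Q) = 0"
        using z T sub w by (intro integral_parity_mult[OF z(1)]) (auto elim!: local_fun_mono)
      moreover have "local_fun V w" "local_fun V (\<lambda>x. parity T x * w x)"
        using sub T local_fun_mono[OF w, of V] by (auto intro!: local_fun_mult local_fun_parity)
      ultimately show "(\<integral>x. parity_law T x * w x \<partial>Q) = (\<integral>x. 1 * 1 * w x \<partial>Q)"
        using local_fun_integrable by (simp add: parity_law_def distrib_right)
    qed (auto simp: local_fun_const depends_only_def)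
  next
    case 2
    then have "local_fun (V - A) (parity_law T)"
      using T by (intro local_fun_parity_law) auto
    then show ?thesis
      by (intro rule[where g = "\<lambda>_. 1" and K = 1 and h = "parity_law T"])
        (auto simp: depends_only_def)
  next
    case 3
    then show ?thesis
      by (intro rule[where g = "parity_law T" and K = "3/2" and h = "\<lambda>_. 1"])
        (use T parity_law_bounds in \<open>auto simp: local_fun_const depends_only_parity_law intro!: parity_law_measurable\<close>)
  qed
qed

definition chain_law :: "'v \<Rightarrow> 'v \<Rightarrow> 'v \<Rightarrow> ('v \<Rightarrow> 'a) \<Rightarrow> real" where
  "chain_law a b c x = parity_law {a, b} x * parity_law {b, c} x"

text \<open>The sign of \<open>b\<close> squares to 1, so the product of the two biases leaves the
  correlation 1/4 between the ends.\<close>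

lemma chain_law_eq:
  assumes "a \<noteq> b" "b \<noteq> c" "a \<noteq> c"
  shows "chain_law a b c x = 1 + parity {a, b} x / 2 + parity {b, c} x / 2 + parity {a, c} x / 4"
proof -
  have "(sign a x * sign b x) * (sign b x * sign c x) = (sign b x * sign b x) * (sign a x * sign c x)"
    by (simp add: mult_ac)
  then have "parity {a, b} x * parity {b, c} x = parity {a, c} x"
    using assms by (simp add: parity_def sign_square)
  then show ?thesis
    unfolding chain_law_def parity_law_def by (simp add: field_simps)
qed

lemma chain_law_density:
  assumes "a \<in> V" "b \<in> V" "c \<in> V" "a \<noteq> b" "b \<noteq> c" "a \<noteq> c"
  shows "local_fun V (chain_law a b c)" "0 \<le> chain_law a b c x" "(\<integral>x. chain_law a b c x \<partial>Q) = 1"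
proof -
  show "local_fun V (chain_law a b c)"
    unfolding chain_law_def[abs_def] using assms by (intro local_fun_mult local_fun_parity_law) auto
  show "0 \<le> chain_law a b c x" using parity_law_bounds by (simp add: chain_law_def)
  have "integrable Q (parity {a, b})" "integrable Q (parity {b, c})" "integrable Q (parity {a, c})"
    using assms by (auto intro!: local_fun_integrable[of V] local_fun_parity)
  then show "(\<integral>x. chain_law a b c x \<partial>Q) = 1"
    using assms integral_parity[of "{a, b}"] integral_parity[of "{b, c}"] integral_parity[of "{a, c}"]
    by (simp add: chain_law_eq P.prob_space)
qed

text \<open>The density is that of a Markov chain through \<open>b\<close>, the other coordinates
  being independent. The hypotheses \<open>sep\<close> say that no link of the chain joins
  \<open>A\<close> to \<open>B\<close> and that \<open>b\<close> is in \<open>C\<close> if the ends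
  lie on opposite sides.\<close>

lemma chain_law_cond_indep:
  assumes V: "a \<in> V" "b \<in> V" "c \<in> V" "a \<noteq> b" "b \<noteq> c" "a \<noteq> c"
    and tri: "disjoint_triple V A B C"
    and sep: "\<not> (a \<in> A \<and> b \<in> B)" "\<not> (b \<in> A \<and> a \<in> B)" "\<not> (b \<in> A \<and> c \<in> B)" "\<not> (c \<in> A \<and> b \<in> B)"
      "a \<in> A \<and> c \<in> B \<Longrightarrow> b \<in> C" "c \<in> A \<and> a \<in> B \<Longrightarrow> b \<in> C"
  shows "cond_indep_var (density Q (chain_law a b c)) (PiM A N) (\<lambda>x. restrict x A)
    (PiM B N) (\<lambda>x. restrict x B) (PiM C N) (\<lambda>x. restrict x C)"
proof -
  have sub: "A \<subseteq> V" "B \<subseteq> V" "C \<subseteq> V" and disj: "A \<inter> (B \<union> C) = {}" "B \<inter> C = {}"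
    using tri by (auto simp: disjoint_triple_def)
  \<comment> \<open>\<open>A'\<close> adds to \<open>A\<close> the vertices of the chain that are joined to \<open>A\<close> along it outside \<open>C\<close>.\<close>
  have "\<exists>A'. A \<subseteq> A' \<and> A' \<subseteq> V \<and> A' \<inter> (B \<union> C) = {} \<and>
      ({a, b} \<subseteq> A' \<union> C \<or> {a, b} \<inter> A' = {}) \<and> ({b, c} \<subseteq> A' \<union> C \<or> {b, c} \<inter> A' = {})"
  \<comment> \<open>If \<open>b\<close> must be averaged along with \<open>A\<close>, the hypotheses
    keep both ends out of \<open>B\<close>. In the other case \<open>b\<close> is in
    \<open>B\<close>, or in \<open>C\<close>, or has no end of the chain in \<open>A\<close>, and
    \<open>A\<close> itself will do.\<close>
  proof (cases "b \<in> A \<or> b \<notin> B \<union> C \<and> (a \<in> A \<or> c \<in> A)")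
    case True
    then show ?thesis
      using sub disj sep V by (intro exI[of _ "A \<union> {b} \<union> ({a, c} - C)"]) auto
  next
    case False
    then show ?thesis
      using sub disj sep by (intro exI[of _ A]) auto
  qed
  then obtain A' where A': "A \<subseteq> A'" "A' \<subseteq> V" "A' \<inter> (B \<union> C) = {}"
    and ab: "{a, b} \<subseteq> A' \<union> C \<or> {a, b} \<inter> A' = {}"
    and bc: "{b, c} \<subseteq> A' \<union> C \<or> {b, c} \<inter> A' = {}" by blast
  \<comment> \<open>Each of the two factors goes entirely to \<open>g\<close> or entirely to
    \<open>h\<close>; by \<open>ab\<close> and \<open>bc\<close> a factor sent to \<open>h\<close>
    reads nothing in \<open>A'\<close>.\<close>
  define g1 where "g1 T = (if T \<subseteq> A' \<union> C then parity_law T else (\<lambda>_. 1))" for T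
  define h1 where "h1 T = (if T \<subseteq> A' \<union> C then (\<lambda>_. 1) else parity_law T)" for T
  have gh: "parity_law T x = g1 T x * h1 T x" for T x by (simp add: g1_def h1_def)
  have g1: "g1 T \<in> borel_measurable (PiM (A' \<union> C) N)" "0 \<le> g1 T x" "g1 T x \<le> 3/2"
      "depends_only (A' \<union> C) (g1 T)" if "T \<subseteq> V" for T x
    using that parity_law_bounds[of T x] depends_only_parity_law[of T "A' \<union> C"]
      parity_law_measurable[of T "A' \<union> C"] by (auto simp: g1_def depends_only_def)
  have h1: "local_fun (V - A') (h1 T)" if "T \<subseteq> A' \<union> C \<or> T \<inter> A' = {}" "T \<subseteq> V" for T
    using that by (auto simp: h1_def local_fun_const intro!: local_fun_parity_law)
  have T: "{a, b} \<subseteq> V" "{b, c} \<subseteq> V" using V by auto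
  show ?thesis
  proof (rule cond_indep_factorisation[OF sub A' chain_law_density[OF V],
      where g = "\<lambda>x. g1 {a, b} x * g1 {b, c} x" and K = "3/2 * (3/2)"
        and h = "\<lambda>x. h1 {a, b} x * h1 {b, c} x"])
    show "(\<lambda>x. g1 {a, b} x * g1 {b, c} x) \<in> borel_measurable (PiM (A' \<union> C) N)"
      using g1(1) T by (intro borel_measurable_times)
    show "0 \<le> g1 {a, b} x * g1 {b, c} x" for x using g1(2) T by simp
    show "g1 {a, b} x * g1 {b, c} x \<le> 3/2 * (3/2)" for x
      using g1(2,3) T by (intro mult_mono) auto
    show "depends_only (A' \<union> C) (\<lambda>x. g1 {a, b} x * g1 {b, c} x)"
      using g1(4)[OF T(1)] g1(4)[OF T(2)] unfolding depends_only_def by metis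
    show "local_fun (V - A') (\<lambda>x. h1 {a, b} x * h1 {b, c} x)"
      using h1 ab bc T by (intro local_fun_mult)
    show "(\<integral>x. chain_law a b c x * w x \<partial>Q)
      = (\<integral>x. g1 {a, b} x * g1 {b, c} x * (h1 {a, b} x * h1 {b, c} x) * w x \<partial>Q)" for w
      unfolding chain_law_def gh by (simp add: mult_ac)
  qed
qed

section \<open>Failure of conditional independence under the test densities\<close>

text \<open>The event of sign 1 has indicator (1 + s) / 2, and \<open>mean\<close> makes its
  conditional probability 1/2 for both vertices. Expanding the joint probability 1/4 then leaves
  only the product of the signs, which must integrate to 0.\<close>

lemma cond_indep_signs:
  assumes ab: "a \<in> V" "b \<in> V" "a \<noteq> b" and C: "C \<subseteq> V" "a \<notin> C" "b \<notin> C"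
    and f: "local_fun V f" "\<And>x. 0 \<le> f x" "(\<integral>x. f x \<partial>Q) = 1"
    and ci: "cond_indep_var (density Q f) (PiM {a} N) (\<lambda>x. restrict x {a})
      (PiM {b} N) (\<lambda>x. restrict x {b}) (PiM C N) (\<lambda>x. restrict x C)"
    and mean: "\<And>w. local_fun C w \<Longrightarrow> (\<integral>x. f x * (w x * sign a x) \<partial>Q) = 0"
      "\<And>w. local_fun C w \<Longrightarrow> (\<integral>x. f x * (w x * sign b x) \<partial>Q) = 0"
    and G: "G \<in> sets (PiM C N)"
  shows "(\<integral>x. f x * (indicator G (restrict x C) * (sign a x * sign b x)) \<partial>Q) = 0"
proof -
  let ?P = "density Q f"
  have P: "prob_space ?P" using f by (rule prob_space_density)
  have int_P: "(\<integral>x. u x \<partial>?P) = (\<integral>x. f x * u x \<partial>Q)" if "u \<in> borel_measurable Q" for u :: "_ \<Rightarrow> real"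
    using that f(1,2) by (rule integral_density_local)
  have rm: "(\<lambda>x. restrict x S) \<in> measurable ?P (PiM S N)" if "S \<subseteq> V" for S
    using measurable_restrict_subset[OF that] by simp
  define E where "E v = {t \<in> space (PiM {v} N). t v \<in> W v}" for v
  have E: "E v \<in> sets (PiM {v} N)" if "v \<in> V" for v
  proof -
    have [measurable]: "W v \<in> sets (N v)" using W_sets that .
    show ?thesis unfolding E_def by measurable
  qed
  define iE where "iE v x = (indicator ((\<lambda>x. restrict x {v}) -` E v \<inter> space ?P) x :: real)" for v x
  have iE: "iE v x = (1 + sign v x) / 2" if "v \<in> V" "x \<in> space Q" for v x
  proof -
    have "restrict x {v} \<in> space (PiM {v} N)"
      using measurable_space[OF rm[of "{v}"]] that by simp
    then show ?thesis using that by (auto simp: iE_def E_def sign_def)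
  qed
  have iH: "\<exists>G\<in>sets (PiM C N). \<forall>x\<in>space Q. indicator H x = (indicator G (restrict x C) :: real)"
    if "H \<in> sets (vimage_algebra (space ?P) (\<lambda>x. restrict x C) (PiM C N))" for H
    using that unfolding sets_vimage_algebra_measurable[OF rm[OF C(1)]] by (auto simp: indicator_def)
  have sgn: "local_fun V (sign a)" "local_fun V (sign b)" using ab by (auto intro: local_fun_sign)
  have half: "(\<integral>x. indicator H x * iE v x \<partial>?P) = 1/2 * (\<integral>x. indicator H x \<partial>?P)"
    if H: "H \<in> sets (vimage_algebra (space ?P) (\<lambda>x. restrict x C) (PiM C N))"
      and v: "v \<in> V" and mean: "\<And>w. local_fun C w \<Longrightarrow> (\<integral>x. f x * (w x * sign v x) \<partial>Q) = 0" for H v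
  proof -
    obtain G where G: "G \<in> sets (PiM C N)"
      "\<And>x. x \<in> space Q \<Longrightarrow> indicator H x = (indicator G (restrict x C) :: real)"
      using iH[OF H] by blast
    define w where "w x = (indicator G (restrict x C) :: real)" for x
    have w: "local_fun C w" unfolding w_def using local_fun_indicator[OF C(1) G(1)] .
    then have wV: "local_fun V w" "local_fun V (sign v)"
      using local_fun_mono C(1) local_fun_sign v by blast+
    then have fw: "integrable Q (\<lambda>x. f x * w x)" "integrable Q (\<lambda>x. f x * (w x * sign v x))"
      using f(1) by (auto intro!: local_fun_integrable[of V] local_fun_mult)
    have "(\<integral>x. indicator H x * iE v x \<partial>?P) = (\<integral>x. w x * ((1 + sign v x) / 2) \<partial>?P)"
      by (intro Bochner_Integration.integral_cong refl) (simp add: G(2) iE v w_def)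
    also have "\<dots> = (\<integral>x. f x * (w x * ((1 + sign v x) / 2)) \<partial>Q)"
      by (rule int_P) (use wV in \<open>auto simp: local_fun_def\<close>)
    also have "\<dots> = (\<integral>x. 1/2 * (f x * w x) + 1/2 * (f x * (w x * sign v x)) \<partial>Q)"
      by (intro Bochner_Integration.integral_cong refl) (simp add: field_simps)
    also have "\<dots> = 1/2 * (\<integral>x. f x * w x \<partial>Q)" using fw mean[OF w] by simp
    also have "(\<integral>x. f x * w x \<partial>Q) = (\<integral>x. w x \<partial>?P)"
      by (rule int_P[symmetric]) (use wV in \<open>auto simp: local_fun_def\<close>)
    also have "\<dots> = (\<integral>x. indicator H x \<partial>?P)"
      by (intro Bochner_Integration.integral_cong refl) (simp add: G(2) w_def)
    finally show ?thesis .
  qed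
  define H where "H = (\<lambda>x. restrict x C) -` G \<inter> space ?P"
  have H: "H \<in> sets (vimage_algebra (space ?P) (\<lambda>x. restrict x C) (PiM C N))"
    unfolding sets_vimage_algebra_measurable[OF rm[OF C(1)]] H_def using G by blast
  have quarter: "(\<integral>x. indicator H x * (iE a x * iE b x) \<partial>?P) = 1/4 * (\<integral>x. indicator H x \<partial>?P)"
    unfolding iE_def
    by (rule cond_indep_var_half[OF P rm rm rm ci E E _ _ H])
      (use half mean ab C in \<open>auto simp: iE_def\<close>)
  define w where "w x = (indicator G (restrict x C) :: real)" for x
  have w: "local_fun C w" unfolding w_def using local_fun_indicator[OF C(1) G] .
  then have wV: "local_fun V w" using local_fun_mono C(1) by blast
  have wH: "indicator H x = w x" if "x \<in> space Q" for x using that by (auto simp: H_def w_def indicator_def)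
  have fw: "integrable Q (\<lambda>x. f x * w x)" "integrable Q (\<lambda>x. f x * (w x * sign a x))"
      "integrable Q (\<lambda>x. f x * (w x * sign b x))" "integrable Q (\<lambda>x. f x * (w x * (sign a x * sign b x)))"
    using f(1) wV sgn by (auto intro!: local_fun_integrable[of V] local_fun_mult)
  have "(\<integral>x. indicator H x * (iE a x * iE b x) \<partial>?P)
      = (\<integral>x. w x * ((1 + sign a x) / 2 * ((1 + sign b x) / 2)) \<partial>?P)"
    by (intro Bochner_Integration.integral_cong refl) (simp add: wH iE ab)
  also have "\<dots> = (\<integral>x. f x * (w x * ((1 + sign a x) / 2 * ((1 + sign b x) / 2))) \<partial>Q)"
    by (rule int_P) (use wV sgn in \<open>auto simp: local_fun_def\<close>)
  also have "\<dots> = (\<integral>x. 1/4 * (f x * w x) + (1/4 * (f x * (w x * sign a x)) + (1/4 * (f x * (w x * sign b x))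
      + 1/4 * (f x * (w x * (sign a x * sign b x))))) \<partial>Q)"
    by (intro Bochner_Integration.integral_cong refl) (simp add: field_simps)
  also have "\<dots> = 1/4 * (\<integral>x. f x * w x \<partial>Q) + 1/4 * (\<integral>x. f x * (w x * (sign a x * sign b x)) \<partial>Q)"
    using fw mean[OF w] by simp
  also have "(\<integral>x. f x * w x \<partial>Q) = (\<integral>x. w x \<partial>?P)"
    by (rule int_P[symmetric]) (use wV in \<open>auto simp: local_fun_def\<close>)
  also have "\<dots> = (\<integral>x. indicator H x \<partial>?P)"
    by (intro Bochner_Integration.integral_cong refl) (simp add: wH)
  finally show ?thesis using quarter by (simp add: w_def)
qed

text \<open>\<open>C0\<close> is empty for a missing edge, where \<open>C\<close> is whatever
  separator the other graph provides, and is the middle vertex for a missing collider. Independence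
  would make the parity of \<open>C0\<close>, a function of the coordinates in \<open>C\<close> with
  values 1 and -1, orthogonal to all indicators on \<open>C\<close>.\<close>

lemma parity_law_not_cond_indep:
  assumes ab: "a \<in> V" "b \<in> V" "a \<noteq> b" and C: "C \<subseteq> V" "a \<notin> C" "b \<notin> C" and C0: "C0 \<subseteq> C"
  shows "\<not> cond_indep_var (density Q (parity_law ({a, b} \<union> C0))) (PiM {a} N) (\<lambda>x. restrict x {a})
      (PiM {b} N) (\<lambda>x. restrict x {b}) (PiM C N) (\<lambda>x. restrict x C)"
proof
  let ?T = "{a, b} \<union> C0"
  assume ci: "cond_indep_var (density Q (parity_law ?T)) (PiM {a} N) (\<lambda>x. restrict x {a})
      (PiM {b} N) (\<lambda>x. restrict x {b}) (PiM C N) (\<lambda>x. restrict x C)"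
  have T: "?T \<subseteq> V" "?T \<noteq> {}" using ab C C0 by auto
  have fin: "finite C0" using finite_subset[OF subset_trans[OF C0 C(1)] finite_index] .
  have law: "parity_law ?T x = 1 + sign a x * (sign b x * parity C0 x) / 2" for x
  proof -
    have "b \<notin> C0" "a \<notin> insert b C0" using ab C C0 by auto
    then show ?thesis
      using parity_insert[of "insert b C0" a x] parity_insert[of C0 b x] fin
      by (simp add: parity_law_def)
  qed
  \<comment> \<open>Separates the constant part of the density from the biased part, so that squares
    of signs cancel in \<open>p * q\<close> on its own.\<close>
  have expand: "(1 + p / 2) * q = q' + 1/2 * r" if "p * q = r" "q = q'" for p q q' r :: real
    by (simp add: distrib_right flip: that)
  have zero: "(\<integral>x. sign v x * u x \<partial>Q) = 0" if "v \<in> V" "local_fun (V - {v}) u" for v u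
    using integral_sign_mult that .
  have intg: "integrable Q u" if "local_fun V u" for u using local_fun_integrable that .
  have mean: "(\<integral>x. parity_law ?T x * (w x * sign v x) \<partial>Q) = 0"
    if w: "local_fun C w" and v: "v = a \<and> v' = b \<or> v = b \<and> v' = a" for w v v'
  proof -
    have vs: "v \<in> V" "v' \<in> V" "v \<noteq> v'" "C \<subseteq> V - {v}" "C \<subseteq> V - {v'}" using v ab C by auto
    have wl: "local_fun (V - {v}) w" "local_fun (V - {v'}) w" "local_fun V w"
      using w vs C local_fun_mono by blast+
    have pl: "local_fun (V - {v'}) (parity C0)" "local_fun V (parity C0)"
      using C C0 vs by (auto intro!: local_fun_parity)
    \<comment> \<open>The first term keeps an unpaired sign at \<open>v\<close>; in the second the
      sign at \<open>v\<close> is squared away and the one at \<open>v'\<close> remains.\<close>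
    have "(\<integral>x. parity_law ?T x * (w x * sign v x) \<partial>Q)
        = (\<integral>x. sign v x * w x + 1/2 * (sign v' x * (w x * parity C0 x)) \<partial>Q)"
    proof (intro Bochner_Integration.integral_cong refl)
      fix x
      have "sign a x * (sign b x * parity C0 x) * (w x * sign v x)
          = (sign v x * sign v x) * (sign v' x * (w x * parity C0 x))"
        using v by (auto simp: mult_ac)
      then show "parity_law ?T x * (w x * sign v x) = sign v x * w x + 1/2 * (sign v' x * (w x * parity C0 x))"
        unfolding law by (intro expand) (simp_all add: sign_square)
    qed
    also have "\<dots> = (\<integral>x. sign v x * w x \<partial>Q) + 1/2 * (\<integral>x. sign v' x * (w x * parity C0 x) \<partial>Q)"
    proof -
      have "integrable Q (\<lambda>x. sign v x * w x)" "integrable Q (\<lambda>x. sign v' x * (w x * parity C0 x))"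
        using wl pl vs by (auto intro!: intg local_fun_mult local_fun_sign)
      then show ?thesis by simp
    qed
    also have "\<dots> = 0"
      using zero[OF vs(1) wl(1)] zero[OF vs(2) local_fun_mult[OF wl(2) pl(1)]] by simp
    finally show ?thesis .
  qed
  have mean_a: "(\<integral>x. parity_law ?T x * (w x * sign a x) \<partial>Q) = 0" if "local_fun C w" for w
    by (rule mean[OF that]) blast
  have mean_b: "(\<integral>x. parity_law ?T x * (w x * sign b x) \<partial>Q) = 0" if "local_fun C w" for w
    by (rule mean[OF that]) blast
  have orth: "(\<integral>x. indicator G (restrict x C) * parity C0 x \<partial>Q) = 0" if G: "G \<in> sets (PiM C N)" for G
  proof -
    define w where "w x = (indicator G (restrict x C) :: real)" for x
    have w: "local_fun C w" unfolding w_def using local_fun_indicator[OF C(1) G] .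
    have wl: "local_fun V w" "local_fun V (parity C0)" "local_fun (V - {a}) w"
      using w C C0 ab local_fun_mono[OF w, of "V - {a}"] local_fun_mono[OF w, of V]
      by (auto intro!: local_fun_parity)
    have sb: "local_fun (V - {a}) (sign b)" "local_fun V (sign a)" "local_fun V (sign b)"
      using ab by (auto intro!: local_fun_sign)
    have "0 = (\<integral>x. parity_law ?T x * (w x * (sign a x * sign b x)) \<partial>Q)"
      unfolding w_def
      using cond_indep_signs[OF ab C local_fun_parity_law[OF T(1,1)] parity_law_bounds(1)
          integral_parity_law[OF T] ci mean_a mean_b G]
      by simp
    \<comment> \<open>Now both signs are squared in the biased part, which reduces to the parity of
      \<open>C0\<close>; the constant part still has an unpaired sign at \<open>a\<close>.\<close>
    also have "\<dots> = (\<integral>x. sign a x * (sign b x * w x) + 1/2 * (w x * parity C0 x) \<partial>Q)"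
    proof (intro Bochner_Integration.integral_cong refl)
      fix x
      have "sign a x * (sign b x * parity C0 x) * (w x * (sign a x * sign b x))
          = (sign a x * sign a x) * (sign b x * sign b x) * (w x * parity C0 x)"
        by (simp add: mult_ac)
      then show "parity_law ?T x * (w x * (sign a x * sign b x))
          = sign a x * (sign b x * w x) + 1/2 * (w x * parity C0 x)"
        unfolding law by (intro expand) (simp_all add: sign_square)
    qed
    also have "\<dots> = (\<integral>x. sign a x * (sign b x * w x) \<partial>Q) + 1/2 * (\<integral>x. w x * parity C0 x \<partial>Q)"
    proof -
      have "integrable Q (\<lambda>x. sign a x * (sign b x * w x))" "integrable Q (\<lambda>x. w x * parity C0 x)"
        using wl sb by (auto intro!: intg local_fun_mult)
      then show ?thesis by simp
    qed
    also have "(\<integral>x. sign a x * (sign b x * w x) \<partial>Q) = 0"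
      by (rule zero[OF ab(1) local_fun_mult[OF sb(1) wl(3)]])
    finally show ?thesis by (simp add: w_def)
  qed
  \<comment> \<open>Applied to the two level sets of the parity of \<open>C0\<close>, \<open>orth\<close> says that both have measure 0,
    although they cover the space.\<close>
  define G where "G s = {z \<in> space (PiM C N). parity C0 z = s}" for s
  have G: "G s \<in> sets (PiM C N)" for s
  proof -
    have [measurable]: "parity C0 \<in> borel_measurable (PiM C N)"
      using C C0 by (intro parity_measurable) auto
    show ?thesis unfolding G_def by measurable
  qed
  have "1 = (\<integral>x. (1::real) \<partial>Q)" by (simp add: P.prob_space)
  also have "\<dots> = (\<integral>x. indicator (G 1) (restrict x C) * parity C0 x - indicator (G (-1)) (restrict x C) * parity C0 x \<partial>Q)"
  proof (intro Bochner_Integration.integral_cong refl)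
    fix x assume x: "x \<in> space Q"
    have "parity C0 (restrict x C) = parity C0 x"
      using C0 by (auto simp: parity_def sign_def intro!: prod.cong)
    moreover have "restrict x C \<in> space (PiM C N)"
      using measurable_space[OF measurable_restrict_subset[OF C(1)] x] .
    moreover have "parity C0 x = 1 \<or> parity C0 x = -1" using abs_parity[of C0 x] by linarith
    ultimately show "1 = indicator (G 1) (restrict x C) * parity C0 x - indicator (G (-1)) (restrict x C) * parity C0 x"
      by (auto simp: G_def indicator_def)
  qed
  also have "\<dots> = (\<integral>x. indicator (G 1) (restrict x C) * parity C0 x \<partial>Q)
      - (\<integral>x. indicator (G (-1)) (restrict x C) * parity C0 x \<partial>Q)"
  proof (rule Bochner_Integration.integral_diff)
    have "local_fun V (\<lambda>x. indicator (G s) (restrict x C) * parity C0 x)" for s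
      using local_fun_mono[OF local_fun_indicator[OF C(1) G[of s]] C(1)] C C0
      by (intro local_fun_mult local_fun_parity) auto
    then show "integrable Q (\<lambda>x. indicator (G 1) (restrict x C) * parity C0 x)"
      "integrable Q (\<lambda>x. indicator (G (-1)) (restrict x C) * parity C0 x)"
      using intg by blast+
  qed
  also have "\<dots> = 0" using orth[OF G] by simp
  finally show False by simp
qed

text \<open>Marginal independence would force the product of the end signs to integrate to 0, but
  its integral is the coefficient 1/4 in \<open>chain_law_eq\<close>.\<close>

lemma chain_law_not_cond_indep:
  assumes V: "a \<in> V" "b \<in> V" "c \<in> V" "a \<noteq> b" "b \<noteq> c" "a \<noteq> c"
  shows "\<not> cond_indep_var (density Q (chain_law a b c)) (PiM {a} N) (\<lambda>x. restrict x {a})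
      (PiM {c} N) (\<lambda>x. restrict x {c}) (PiM {} N) (\<lambda>x. restrict x {})"
proof
  assume ci: "cond_indep_var (density Q (chain_law a b c)) (PiM {a} N) (\<lambda>x. restrict x {a})
      (PiM {c} N) (\<lambda>x. restrict x {c}) (PiM {} N) (\<lambda>x. restrict x {})"
  have law: "chain_law a b c x
      = 1 + sign a x * sign b x / 2 + sign b x * sign c x / 2 + sign a x * sign c x / 4" for x
    using chain_law_eq[of a b c x] V by (simp add: parity_def)
  have intg: "integrable Q u" if "local_fun V u" for u using local_fun_integrable that .
  have zero: "(\<integral>x. sign v x * u x \<partial>Q) = 0" if "v \<in> V" "local_fun (V - {v}) u" for v u
    using integral_sign_mult that .
  have sl: "local_fun (V - {a}) (sign b)" "local_fun (V - {a}) (sign c)" "local_fun V (sign a)"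
    "local_fun V (sign b)" "local_fun V (sign c)" "local_fun (V - {b}) (sign c)"
    using V by (auto intro!: local_fun_sign)
  have mean: "(\<integral>x. chain_law a b c x * (w x * sign a x) \<partial>Q) = 0"
    "(\<integral>x. chain_law a b c x * (w x * sign c x) \<partial>Q) = 0" if "local_fun {} w" for w
  proof -
    \<comment> \<open>A function of no coordinates is local on every set, so \<open>w\<close> does
      not interfere with any of the unpaired signs below.\<close>
    have w: "local_fun S w" for S using local_fun_mono[OF that] by blast
    let ?I = "\<lambda>u. (\<integral>x. u x \<partial>Q)"
    have z: "?I (\<lambda>x. sign a x * w x) = 0" "?I (\<lambda>x. sign b x * w x) = 0" "?I (\<lambda>x. sign c x * w x) = 0"
      "?I (\<lambda>x. sign a x * (sign b x * (sign c x * w x))) = 0"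
      using zero[OF V(1) w] zero[OF V(2) w] zero[OF V(3) w]
        zero[OF V(1) local_fun_mult[OF sl(1) local_fun_mult[OF sl(2) w]]] by auto
    have i: "integrable Q (\<lambda>x. sign a x * w x)" "integrable Q (\<lambda>x. sign b x * w x)"
      "integrable Q (\<lambda>x. sign c x * w x)" "integrable Q (\<lambda>x. sign a x * (sign b x * (sign c x * w x)))"
      using w sl by (auto intro!: intg local_fun_mult)
    have "?I (\<lambda>x. chain_law a b c x * (w x * sign a x))
      = ?I (\<lambda>x. sign a x * w x + (1/2 * (sign b x * w x)
          + (1/2 * (sign a x * (sign b x * (sign c x * w x))) + 1/4 * (sign c x * w x))))"
      by (intro Bochner_Integration.integral_cong refl) (auto simp: law sign_def)
    then show "?I (\<lambda>x. chain_law a b c x * (w x * sign a x)) = 0" using z i by simp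
    have "?I (\<lambda>x. chain_law a b c x * (w x * sign c x))
      = ?I (\<lambda>x. sign c x * w x + (1/2 * (sign a x * (sign b x * (sign c x * w x)))
          + (1/2 * (sign b x * w x) + 1/4 * (sign a x * w x))))"
      by (intro Bochner_Integration.integral_cong refl) (auto simp: law sign_def)
    then show "?I (\<lambda>x. chain_law a b c x * (w x * sign c x)) = 0" using z i by simp
  qed
  have "0 = (\<integral>x. chain_law a b c x * (indicator (space (PiM {} N)) (restrict x {}) * (sign a x * sign c x)) \<partial>Q)"
    using cond_indep_signs[OF V(1,3,6) _ _ _ chain_law_density[OF V] ci mean sets.top] by simp
  also have "\<dots> = (\<integral>x. sign a x * sign c x + (1/2 * (sign b x * sign c x) + (1/2 * (sign a x * sign b x) + 1/4)) \<partial>Q)"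
    by (intro Bochner_Integration.integral_cong refl)
      (auto simp: law space_PiM_empty sign_def restrict_def)
  also have "\<dots> = 1/4"
    using zero[OF V(1) sl(2)] zero[OF V(2) sl(6)] zero[OF V(1) sl(1)]
      intg[OF local_fun_mult[OF sl(3,5)]] intg[OF local_fun_mult[OF sl(4,5)]] intg[OF local_fun_mult[OF sl(3,4)]]
    by (simp add: P.prob_space)
  finally show False by simp
qed

end

section \<open>Inclusion of models\<close>

text \<open>Only the measurable sets of the targets matter, which allows \<open>\<mu>\<close> to be
  exchanged for \<open>N\<close> in statements of independence.\<close>

lemma cond_indep_var_cong:
  assumes "sets S = sets S'" "sets T = sets T'" "sets U = sets U'"
  shows "cond_indep_var P S X T Y U Z = cond_indep_var P S' X T' Y U' Z"
proof -
  have "vimage_algebra (space P) Z U = vimage_algebra (space P) Z U'"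
    using assms(3) by (simp add: vimage_algebra_def)
  then show ?thesis using assms(1,2) by (simp add: cond_indep_var_def)
qed

lemma d_separated_mono: "d_separated D A B C \<Longrightarrow> A' \<subseteq> A \<Longrightarrow> B' \<subseteq> B \<Longrightarrow> d_separated D A' B' C"
  unfolding d_separated_def by blast

lemma d_separated_adjacent:
  assumes "dag V D" "d_separated D A B C" "{u, v} \<in> skeleton D"
  shows "\<not> (u \<in> A \<and> v \<in> B)" "\<not> (v \<in> A \<and> u \<in> B)"
proof -
  have "{v, u} \<in> skeleton D" using assms(3) by (simp add: insert_commute)
  then show "\<not> (u \<in> A \<and> v \<in> B)" "\<not> (v \<in> A \<and> u \<in> B)"
    using adjacent_not_d_separated[OF assms(1)] assms by blast+
qed

lemma cpdag_model_cpdag_of: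
  assumes "polytree V D"
  shows "cpdag_model V \<mu> (cpdag_of V D) =
    {P. prob_space P \<and> sets P = sets (PiM V \<mu>) \<and> absolutely_continuous (PiM V \<mu>) P \<and>
       (\<forall>A B C. disjoint_triple V A B C \<longrightarrow> d_separated D A B C \<longrightarrow>
          cond_indep_var P (PiM A \<mu>) (\<lambda>x. restrict x A) (PiM B \<mu>) (\<lambda>x. restrict x B)
            (PiM C \<mu>) (\<lambda>x. restrict x C))}"
proof -
  have "D \<in> dags_of V (cpdag_of V D)"
    using assms by (simp add: dags_of_def polytree_dag)
  moreover have "d_separated D' A B C \<longleftrightarrow> d_separated D A B C"
    if "D' \<in> dags_of V (cpdag_of V D)" for D' A B C
  proof -
    have "dag V D'" "embeds D D'" "embeds D' D" using dags_of_cpdag_of[OF assms] that by blast+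
    then show ?thesis using embeds_d_separated polytree_dag[OF assms] by blast
  qed
  ultimately show ?thesis unfolding cpdag_model_def by blast
qed

lemma embeds_cpdag_model:
  assumes "polytree V D1" "polytree V D2" "embeds D1 D2"
  shows "cpdag_model V \<mu> (cpdag_of V D1) \<subseteq> cpdag_model V \<mu> (cpdag_of V D2)"
  unfolding cpdag_model_cpdag_of[OF assms(1)] cpdag_model_cpdag_of[OF assms(2)]
  using embeds_d_separated[OF polytree_dag[OF assms(1)] assms(3)] by blast

context fair_events
begin

text \<open>The common form of the three refutations: a test density that satisfies the separations
  of \<open>D1\<close> defines a member of the smaller model, so it must satisfy those of
  \<open>D2\<close>.\<close>

lemma cpdag_model_transfer:
  assumes \<mu>: "\<forall>v\<in>V. sets (\<mu> v) = sets (N v)" and ac: "absolutely_continuous (PiM V \<mu>) Q"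
    and D: "polytree V D1" "polytree V D2"
    and le: "cpdag_model V \<mu> (cpdag_of V D1) \<subseteq> cpdag_model V \<mu> (cpdag_of V D2)"
    and f: "local_fun V f" "\<And>x. 0 \<le> f x" "(\<integral>x. f x \<partial>Q) = 1"
    and ci: "\<And>A B C. disjoint_triple V A B C \<Longrightarrow> d_separated D1 A B C \<Longrightarrow>
      cond_indep_var (density Q f) (PiM A N) (\<lambda>x. restrict x A) (PiM B N) (\<lambda>x. restrict x B)
        (PiM C N) (\<lambda>x. restrict x C)"
    and tri: "disjoint_triple V A B C" and sep: "d_separated D2 A B C"
  shows "cond_indep_var (density Q f) (PiM A N) (\<lambda>x. restrict x A) (PiM B N) (\<lambda>x. restrict x B)
    (PiM C N) (\<lambda>x. restrict x C)"
proof -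
  have sets_eq: "sets (PiM S \<mu>) = sets (PiM S N)" if "S \<subseteq> V" for S
    using \<mu> that by (intro sets_PiM_cong) auto
  have cong: "cond_indep_var (density Q f) (PiM A \<mu>) X (PiM B \<mu>) Y (PiM C \<mu>) Z
      = cond_indep_var (density Q f) (PiM A N) X (PiM B N) Y (PiM C N) Z"
    if "disjoint_triple V A B C" for A B C X Y Z
    using that by (intro cond_indep_var_cong sets_eq) (auto simp: disjoint_triple_def)
  have "absolutely_continuous Q (density Q f)"
    using local_fun_measurable[OF f(1)] by (intro absolutely_continuousI_density) auto
  then have "absolutely_continuous (PiM V \<mu>) (density Q f)"
    using ac by (auto simp: absolutely_continuous_def)
  then have "density Q f \<in> cpdag_model V \<mu> (cpdag_of V D1)"
    using prob_space_density[OF f] sets_eq[OF subset_refl] ci cong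
    unfolding cpdag_model_cpdag_of[OF D(1)] by simp
  then have "density Q f \<in> cpdag_model V \<mu> (cpdag_of V D2)" using le by blast
  then show ?thesis
    using tri sep cong[OF tri] unfolding cpdag_model_cpdag_of[OF D(2)] by blast
qed

lemma cpdag_model_subset_embeds:
  assumes \<mu>: "\<forall>v\<in>V. sets (\<mu> v) = sets (N v)" and ac: "absolutely_continuous (PiM V \<mu>) Q"
    and D: "polytree V D1" "polytree V D2"
    and le: "cpdag_model V \<mu> (cpdag_of V D1) \<subseteq> cpdag_model V \<mu> (cpdag_of V D2)"
  shows "embeds D1 D2"
proof -
  note dag = polytree_dag[OF D(1)] polytree_dag[OF D(2)]
  note transfer = cpdag_model_transfer[OF \<mu> ac D le]
  have inV: "u \<in> V" "v \<in> V" "u \<noteq> v" if "{u, v} \<in> skeleton D1" for u v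
    using that dag(1) dag_irrefl[OF dag(1), of u] by (auto simp: skeleton_iff dag_def)
  have sk: "skeleton D1 \<subseteq> skeleton D2"
  proof
    fix e assume e: "e \<in> skeleton D1"
    then obtain a b where ab: "e = {a, b}" by (auto simp: skeleton_def)
    note V = inV[of a b, OF e[unfolded ab]]
    show "e \<in> skeleton D2"
    proof (rule ccontr)
      assume "e \<notin> skeleton D2"
      then obtain C where C: "C \<subseteq> V" "a \<notin> C" "b \<notin> C" "d_separated D2 {a} {b} C"
        using polytree_nonadjacent_d_separated[OF D(2) V(3)] ab by blast
      have T: "{a, b} \<subseteq> V" "{a, b} \<noteq> {}" using V by auto
      have "cond_indep_var (density Q (parity_law {a, b})) (PiM {a} N) (\<lambda>x. restrict x {a})
          (PiM {b} N) (\<lambda>x. restrict x {b}) (PiM C N) (\<lambda>x. restrict x C)"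
      proof (rule transfer[OF _ parity_law_bounds(1) integral_parity_law[OF T]])
        show "local_fun V (parity_law {a, b})" using T by (intro local_fun_parity_law)
        show "disjoint_triple V {a} {b} C" using V C by (auto simp: disjoint_triple_def)
        fix A B C assume tri: "disjoint_triple V A B C" and sep: "d_separated D1 A B C"
        show "cond_indep_var (density Q (parity_law {a, b})) (PiM A N) (\<lambda>x. restrict x A)
          (PiM B N) (\<lambda>x. restrict x B) (PiM C N) (\<lambda>x. restrict x C)"
          using d_separated_adjacent[OF dag(1) sep e[unfolded ab]] tri
          by (intro parity_law_cond_indep[OF T tri]) (auto simp: disjoint_triple_def)
      qed (rule C(4))
      then show False
        using parity_law_not_cond_indep[OF V C(1,2,3), of "{}"] by simp
    qed
  qed
  show ?thesis
    unfolding embeds_def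
  proof (intro conjI allI impI iffI sk)
    fix u w v
    assume uv: "u \<noteq> v" and e: "{u, w} \<in> skeleton D1" "{v, w} \<in> skeleton D1"
    note V = inV[OF e(1)] inV[OF e(2)]
    have e2: "{u, w} \<in> skeleton D2" "{v, w} \<in> skeleton D2" using e sk by auto
    note sep1 = polytree_triple_d_separated[OF D(1) e uv] polytree_triple_d_separated[OF D(1) e(2,1) uv[symmetric]]
    note sep2 = polytree_triple_d_separated[OF D(2) e2 uv]
    have csym: "collider D1 v w u \<longleftrightarrow> collider D1 u w v" by (auto simp: collider_def)
    have single: "d_separated D1 {x} {y} C" if "d_separated D1 A B C" "x \<in> A" "y \<in> B" for x y A B C
      using d_separated_mono[OF that(1), of "{x}" "{y}"] that(2,3) by simp
    show "collider D2 u w v" if col: "collider D1 u w v"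
    proof (rule ccontr)
      assume "\<not> collider D2 u w v"
      then have sep: "d_separated D2 {u} {v} {w}" using sep2 by simp
      let ?T = "{u, v} \<union> {w}"
      have T: "?T \<subseteq> V" "?T \<noteq> {}" using V by auto
      have "cond_indep_var (density Q (parity_law ?T)) (PiM {u} N) (\<lambda>x. restrict x {u})
          (PiM {v} N) (\<lambda>x. restrict x {v}) (PiM {w} N) (\<lambda>x. restrict x {w})"
      proof (rule transfer[OF _ parity_law_bounds(1) integral_parity_law[OF T]])
        show "local_fun V (parity_law ?T)" using T by (intro local_fun_parity_law)
        show "disjoint_triple V {u} {v} {w}" using V uv by (auto simp: disjoint_triple_def)
        fix A B C assume tri: "disjoint_triple V A B C" and sep: "d_separated D1 A B C"
        \<comment> \<open>With \<open>u\<close> and \<open>v\<close> on opposite sides the collider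
          \<open>w\<close> must lie outside \<open>C\<close>; but in \<open>A\<close> or
          \<open>B\<close> it would be adjacent to a vertex of the opposite side.\<close>
        have no: "w \<notin> C" if "u \<in> A \<and> v \<in> B \<or> v \<in> A \<and> u \<in> B"
          using that single[OF sep] sep1[of C] col csym by auto
        show "cond_indep_var (density Q (parity_law ?T)) (PiM A N) (\<lambda>x. restrict x A)
          (PiM B N) (\<lambda>x. restrict x B) (PiM C N) (\<lambda>x. restrict x C)"
        proof (rule parity_law_cond_indep[OF T tri])
          assume sub: "?T \<subseteq> A \<union> B \<union> C"
          have "A \<inter> B = {}" "A \<inter> C = {}" "B \<inter> C = {}" using tri by (auto simp: disjoint_triple_def)
          then show "?T \<inter> A = {} \<or> ?T \<inter> B = {}"
            using d_separated_adjacent[OF dag(1) sep e(1)] d_separated_adjacent[OF dag(1) sep e(2)] no sub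
            by auto
        qed
      qed (rule sep)
      moreover have "{w} \<subseteq> V" "u \<notin> {w}" "v \<notin> {w}" using V by auto
      ultimately show False
        using parity_law_not_cond_indep[OF V(1,4) uv _ _ _ subset_refl] by blast
    qed
    show "collider D1 u w v" if col: "collider D2 u w v"
    proof (rule ccontr)
      assume ncol: "\<not> collider D1 u w v"
      have sep: "d_separated D2 {u} {v} {}" using sep2 col by simp
      have V': "u \<in> V" "w \<in> V" "v \<in> V" "u \<noteq> w" "w \<noteq> v" "u \<noteq> v" using V uv by auto
      have "cond_indep_var (density Q (chain_law u w v)) (PiM {u} N) (\<lambda>x. restrict x {u})
          (PiM {v} N) (\<lambda>x. restrict x {v}) (PiM {} N) (\<lambda>x. restrict x {})"
      proof (rule transfer[OF chain_law_density[OF V']])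
        show "disjoint_triple V {u} {v} {}" using V uv by (auto simp: disjoint_triple_def)
        fix A B C assume tri: "disjoint_triple V A B C" and sep: "d_separated D1 A B C"
        \<comment> \<open>In \<open>D1\<close> the path through the non-collider \<open>w\<close>
          can be blocked only by \<open>w\<close> itself.\<close>
        have yes: "w \<in> C" if "u \<in> A \<and> v \<in> B \<or> v \<in> A \<and> u \<in> B"
          using that single[OF sep] sep1[of C] ncol csym by auto
        show "cond_indep_var (density Q (chain_law u w v)) (PiM A N) (\<lambda>x. restrict x A)
          (PiM B N) (\<lambda>x. restrict x B) (PiM C N) (\<lambda>x. restrict x C)"
          using d_separated_adjacent[OF dag(1) sep e(1)] d_separated_adjacent[OF dag(1) sep e(2)] yes
          by (intro chain_law_cond_indep[OF V' tri]) auto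
      qed (rule sep)
      then show False using chain_law_not_cond_indep[OF V'] by blast
    qed
  qed
qed

end

text \<open>Weighting two disjoint sets of positive measure by a positive integrable function makes
  each of them an event of probability \<open>1/2\<close>.\<close>
lemma nondegenerate_fair_density:
  assumes "sigma_finite_measure M" "nondegenerate M"
  shows "\<exists>d W. d \<in> borel_measurable M \<and> prob_space (density M d) \<and> W \<in> sets M \<and>
    measure (density M d) W = 1/2"
proof -
  interpret sigma_finite_measure M by fact
  obtain A B where AB[measurable]: "A \<in> sets M" "B \<in> sets M" and disj: "A \<inter> B = {}"
    and pos: "emeasure M A > 0" "emeasure M B > 0"
    using assms(2) by (auto simp: nondegenerate_def)
  \<comment> \<open>The weight \<open>h\<close> gives \<open>A\<close> and \<open>B\<close> finite
    positive mass even where \<open>M\<close> is infinite on them.\<close>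
  obtain h :: "'a \<Rightarrow> ennreal" where h[measurable]: "h \<in> borel_measurable M" and fin: "integral\<^sup>N M h \<noteq> \<infinity>"
    and hpos: "\<And>x. x \<in> space M \<Longrightarrow> 0 < h x \<and> h x < \<infinity>"
    using Ex_finite_integrable_function by blast
  define m where "m S = (\<integral>\<^sup>+x. h x * indicator S x \<partial>M)" for S
  have m: "0 < m S" "m S < \<infinity>" if S[measurable]: "S \<in> sets M" and "emeasure M S > 0" for S
  proof -
    have "m S \<noteq> 0"
    proof
      assume "m S = 0"
      then have "AE x in M. h x * indicator S x = 0"
        unfolding m_def by (subst (asm) nn_integral_0_iff_AE) auto
      then have "AE x in M. x \<notin> S"
        using AE_space by eventually_elim (use hpos in \<open>force simp: indicator_def split: if_splits\<close>)
      then have "emeasure M S = 0" using AE_iff_null_sets[OF S] by (auto simp: null_sets_def)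
      then show False using \<open>emeasure M S > 0\<close> by simp
    qed
    then show "0 < m S" by (simp add: zero_less_iff_neq_zero)
    have "m S \<le> integral\<^sup>N M h"
      unfolding m_def by (intro nn_integral_mono) (auto simp: indicator_def)
    then show "m S < \<infinity>" using fin by (simp add: less_top order_le_less_trans)
  qed
  define d where "d x = h x * indicator A x / (2 * m A) + h x * indicator B x / (2 * m B)" for x
  have d[measurable]: "d \<in> borel_measurable M" unfolding d_def by measurable
  \<comment> \<open>In \<open>ennreal\<close> this cancellation needs \<open>m S\<close> to be
    neither 0 nor infinite.\<close>
  have half: "m S / (2 * m S) = ennreal (1/2)" if S: "S \<in> sets M" "emeasure M S > 0" for S
  proof -
    obtain r where r: "m S = ennreal r" "0 < r"
      using m[OF S] by (cases "m S") auto
    then have "2 * m S = ennreal (2 * r)" by (subst ennreal_mult) auto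
    then show ?thesis using r divide_ennreal[of r "2 * r"] by simp
  qed
  have dA: "(\<integral>\<^sup>+x. d x * indicator A x \<partial>M) = ennreal (1/2)"
  proof -
    have "(\<integral>\<^sup>+x. d x * indicator A x \<partial>M) = (\<integral>\<^sup>+x. h x * indicator A x / (2 * m A) \<partial>M)"
      using disj by (intro nn_integral_cong) (auto simp: d_def indicator_def)
    also have "\<dots> = m A / (2 * m A)"
      unfolding m_def by (rule nn_integral_divide) measurable
    finally show ?thesis using half AB(1) pos(1) by simp
  qed
  have d1: "(\<integral>\<^sup>+x. d x \<partial>M) = 1"
  proof -
    have "(\<integral>\<^sup>+x. d x \<partial>M) = (\<integral>\<^sup>+x. h x * indicator A x / (2 * m A) \<partial>M) + (\<integral>\<^sup>+x. h x * indicator B x / (2 * m B) \<partial>M)"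
      unfolding d_def by (rule nn_integral_add) measurable
    also have "\<dots> = m A / (2 * m A) + m B / (2 * m B)"
      unfolding m_def by (simp add: nn_integral_divide)
    also have "\<dots> = ennreal (1/2) + ennreal (1/2)" using half AB pos by simp
    also have "\<dots> = 1" by (subst ennreal_plus[symmetric]) auto
    finally show ?thesis .
  qed
  have "emeasure (density M d) (space M) = 1"
    using d1 by (subst emeasure_density) (auto intro!: nn_integral_cong cong: nn_integral_cong)
  then have "prob_space (density M d)" by (intro prob_spaceI) simp
  moreover have "measure (density M d) A = 1/2"
    unfolding measure_def emeasure_density[OF d AB(1)] dA by (rule enn2real_ennreal) simp
  ultimately show ?thesis using d AB(1) by blast
qed

text \<open>Both orders reduce to embeddings. What remains is a product probability measure with
  fair events that is absolutely continuous with respect to the product of the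
  \<open>\<mu> v\<close>.\<close>

lemma poly_order_eq_subgraph_order:
  fixes V :: "'v set" and \<mu> :: "'v \<Rightarrow> 'a measure"
  assumes finite_V: "finite V"
    and sigma_finite: "\<And>v. v \<in> V \<Longrightarrow> sigma_finite_measure (\<mu> v)"
    and nondegenerate: "\<And>v. v \<in> V \<Longrightarrow> nondegenerate (\<mu> v)"
  shows "poly_order V \<mu> = subgraph_order V"
proof -
  have "\<forall>v\<in>V. \<exists>d W. d \<in> borel_measurable (\<mu> v) \<and> prob_space (density (\<mu> v) d) \<and> W \<in> sets (\<mu> v) \<and>
      measure (density (\<mu> v) d) W = 1/2"
    using nondegenerate_fair_density sigma_finite nondegenerate by blast
  then obtain d W where dW: "\<And>v. v \<in> V \<Longrightarrow> d v \<in> borel_measurable (\<mu> v) \<and> prob_space (density (\<mu> v) (d v)) \<and>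
      W v \<in> sets (\<mu> v) \<and> measure (density (\<mu> v) (d v)) (W v) = 1/2"
    by metis
  \<comment> \<open>Product locales demand well-behaved measures at all indices, so point masses
    fill the places outside \<open>V\<close>; the product over \<open>V\<close> does not
    change.\<close>
  define \<nu> where "\<nu> v = (if v \<in> V then \<mu> v else return (count_space UNIV) undefined)" for v
  define N where "N v = (if v \<in> V then density (\<mu> v) (d v) else return (count_space UNIV) undefined)" for v
  have prob_N: "prob_space (N v)" for v
    using dW by (auto simp: N_def intro!: prob_space_return)
  interpret N: product_sigma_finite N
    by unfold_locales (meson prob_N prob_space_imp_sigma_finite sigma_finite_measure.sigma_finite_countable)
  have sf: "sigma_finite_measure (\<nu> v)" for v
    using sigma_finite by (auto simp: \<nu>_def intro!: prob_space_imp_sigma_finite prob_space_return)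
  interpret \<nu>: product_sigma_finite \<nu>
    using sf by (simp add: product_sigma_finite_def)
  interpret fair_events N V W
    by unfold_locales (use finite_V prob_N dW in \<open>auto simp: N_def prob_space.emeasure_space_1\<close>)
  have PiM_eq: "PiM V \<mu> = PiM V \<nu>" by (rule PiM_cong) (auto simp: \<nu>_def)
  define dd where "dd x = (\<Prod>v\<in>V. d v (x v))" for x
  have dv[measurable]: "d v \<in> borel_measurable (\<nu> v)" if "v \<in> V" for v using dW that by (simp add: \<nu>_def)
  have dd[measurable]: "dd \<in> borel_measurable (PiM V \<nu>)"
    unfolding dd_def
    by (intro borel_measurable_prod_ennreal measurable_compose[OF _ dv] measurable_component_singleton)
  \<comment> \<open>It suffices to compare boxes, where the density and the indicator both factorise
    over the coordinates.\<close>
  have "density (PiM V \<nu>) dd = PiM V N"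
  proof (rule N.PiM_eqI[OF finite_V])
    have "sets (PiM V \<nu>) = sets (PiM V N)"
      by (rule sets_PiM_cong) (auto simp: \<nu>_def N_def)
    then show "sets (density (PiM V \<nu>) dd) = sets (PiM V N)" by simp
    fix A assume A: "\<And>v. v \<in> V \<Longrightarrow> A v \<in> sets (N v)"
    then have A': "A v \<in> sets (\<nu> v)" if "v \<in> V" for v using that by (auto simp: N_def \<nu>_def)
    have "emeasure (density (PiM V \<nu>) dd) (Pi\<^sub>E V A) = (\<integral>\<^sup>+x. dd x * indicator (Pi\<^sub>E V A) x \<partial>PiM V \<nu>)"
      by (rule emeasure_density[OF dd]) (use A' finite_V in \<open>auto intro!: sets_PiM_I_finite\<close>)
    also have "\<dots> = (\<integral>\<^sup>+x. (\<Prod>v\<in>V. d v (x v) * indicator (A v) (x v)) \<partial>PiM V \<nu>)"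
    proof (rule nn_integral_cong)
      fix x assume x: "x \<in> space (PiM V \<nu>)"
      have "(indicator (Pi\<^sub>E V A) x :: ennreal) = (\<Prod>v\<in>V. indicator (A v) (x v))"
      proof (cases "\<forall>v\<in>V. x v \<in> A v")
        case True
        then show ?thesis using x by (auto simp: indicator_def space_PiM PiE_iff)
      next
        case False
        then have "(\<Prod>v\<in>V. indicator (A v) (x v)) = (0 :: ennreal)"
          using finite_V by (intro prod_zero) (auto simp: indicator_def)
        then show ?thesis using False by (auto simp: indicator_def PiE_iff)
      qed
      then show "dd x * indicator (Pi\<^sub>E V A) x = (\<Prod>v\<in>V. d v (x v) * indicator (A v) (x v))"
        by (simp add: dd_def prod.distrib)
    qed
    also have "\<dots> = (\<Prod>v\<in>V. \<integral>\<^sup>+t. d v t * indicator (A v) t \<partial>\<nu> v)"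
      by (rule \<nu>.product_nn_integral_prod[OF finite_V]) (use dv A' in auto)
    also have "\<dots> = (\<Prod>v\<in>V. emeasure (N v) (A v))"
    proof (rule prod.cong[OF refl])
      fix v assume v: "v \<in> V"
      show "(\<integral>\<^sup>+t. d v t * indicator (A v) t \<partial>\<nu> v) = emeasure (N v) (A v)"
        using dv[OF v] A'[OF v] v by (simp add: N_def \<nu>_def emeasure_density)
    qed
    finally show "emeasure (density (PiM V \<nu>) dd) (Pi\<^sub>E V A) = (\<Prod>v\<in>V. emeasure (N v) (A v))" .
  qed
  then have ac: "absolutely_continuous (PiM V \<mu>) (PiM V N)"
    using absolutely_continuousI_density[OF dd] by (simp add: PiM_eq)
  have sets_N: "\<forall>v\<in>V. sets (\<mu> v) = sets (N v)" by (simp add: N_def)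
  have iff: "cpdag_model V \<mu> (cpdag_of V D1) \<subseteq> cpdag_model V \<mu> (cpdag_of V D2) \<longleftrightarrow> embeds D1 D2"
    if "polytree V D1" "polytree V D2" for D1 D2
    using cpdag_model_subset_embeds[OF sets_N ac that] embeds_cpdag_model[OF that] by blast
  have "(G1, G2) \<in> poly_order V \<mu> \<longleftrightarrow> (G1, G2) \<in> subgraph_order V" for G1 G2
  proof (cases "G1 \<in> polytree_cpdags V \<and> G2 \<in> polytree_cpdags V")
    case True
    then obtain D1 D2 where D: "polytree V D1" "G1 = cpdag_of V D1" "polytree V D2" "G2 = cpdag_of V D2"
      by (auto simp: polytree_cpdags_iff)
    have "(G1, G2) \<in> poly_order V \<mu> \<longleftrightarrow> cpdag_model V \<mu> G1 \<subseteq> cpdag_model V \<mu> G2"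
      using True by (simp add: poly_order_def)
    then show ?thesis using iff[OF D(1,3)] subgraph_order_cpdag_of[OF D(1,3)] D by simp
  next
    case False
    then show ?thesis by (auto simp: poly_order_def subgraph_order_def)
  qed
  then show ?thesis by auto
qed

theorem theorem5:
  fixes V :: "'v set" and \<mu> :: "'v \<Rightarrow> 'a measure"
  assumes finite_V: "finite V"
    and sigma_finite: "\<And>v. v \<in> V \<Longrightarrow> sigma_finite_measure (\<mu> v)"
    and nondegenerate: "\<And>v. v \<in> V \<Longrightarrow> nondegenerate (\<mu> v)"
  shows
    "partial_order_on (polytree_cpdags V) (poly_order V \<mu>) \<and>
     (empty_pdag \<in> polytree_cpdags V \<and>
        (\<forall>G\<in>polytree_cpdags V. (empty_pdag, G) \<in> poly_order V \<mu>) \<and>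
        (card V > 2 \<longrightarrow>
           \<not> (\<exists>M\<in>polytree_cpdags V. \<forall>G\<in>polytree_cpdags V. (G, M) \<in> poly_order V \<mu>))) \<and>
     (\<forall>G1\<in>polytree_cpdags V. \<forall>G2\<in>polytree_cpdags V.
        (G1, G2) \<in> poly_order V \<mu> \<longleftrightarrow> (\<exists>D1\<in>dags_of V G1. \<exists>D2\<in>dags_of V G2. D1 \<subseteq> D2)) \<and>
     graded_with_rank (poly_order V \<mu>) num_edges \<and>
     lower_semimodular (poly_order V \<mu>) \<and>
     (\<forall>Gs\<in>polytree_cpdags V. \<forall>Gt\<in>polytree_cpdags V.
        poset_dist (poly_order V \<mu>) Gs Gt = down_up_dist (poly_order V \<mu>) Gs Gt)"
proof -
  have eq: "poly_order V \<mu> = subgraph_order V"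
    using assms by (rule poly_order_eq_subgraph_order)
  have Field: "G \<in> Field (subgraph_order V)" if "G \<in> polytree_cpdags V" for G
    using that by (simp add: Field_subgraph_order)
  show ?thesis
    unfolding eq
  proof (intro conjI ballI impI)
    show "partial_order_on (polytree_cpdags V) (subgraph_order V)"
      by (rule partial_order_subgraph_order)
    show "empty_pdag \<in> polytree_cpdags V" by (rule empty_polytree_cpdag)
    show "(empty_pdag, G) \<in> subgraph_order V" if "G \<in> polytree_cpdags V" for G
      using that by (rule empty_least)
    show "\<not> (\<exists>M\<in>polytree_cpdags V. \<forall>G\<in>polytree_cpdags V. (G, M) \<in> subgraph_order V)"
      if "card V > 2"
      using that by (rule no_greatest)
    show "(G1, G2) \<in> subgraph_order V \<longleftrightarrow> (\<exists>D1\<in>dags_of V G1. \<exists>D2\<in>dags_of V G2. D1 \<subseteq> D2)"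
      if "G1 \<in> polytree_cpdags V" "G2 \<in> polytree_cpdags V" for G1 G2
      using that by (simp add: subgraph_order_def)
    show "graded_with_rank (subgraph_order V) num_edges"
      using finite_V by (rule graded_subgraph_order)
    show "lower_semimodular (subgraph_order V)"
      using finite_V by (rule lower_semimodular_subgraph_order)
    show "poset_dist (subgraph_order V) Gs Gt = down_up_dist (subgraph_order V) Gs Gt"
      if "Gs \<in> polytree_cpdags V" for Gs Gt
      using lower_semimodular_subgraph_order[OF finite_V] Field[OF that]
      by (rule poset_dist_eq_down_up_dist)
  qed
qed

end
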